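(* Let $n\ge 3$, $1\le k\le n-3$, $r\ge 2$, and let $d$ be a divisor of $n$ with $2\le d\le n/3$; put $j=n/d$. Then there is a bijection between $G_{rd}(n,k;\rho^j)$ and $G^r(j,k/d-\delta_{r2})$.
   Context: A dissection of a convex regular $m$-gon (vertices labelled $0,\dots,m-1$ cyclically) is a set of pairwise non-crossing diagonals; $G(m,l)$ is the set of dissections with $l$ diagonals, taken to be empty if $l$ is not a nonnegative integer. Components: the $m+l$ edges (sides and diagonals) are the 2-components; for $r\ge 3$ the $r$-components are the faces with $r$ vertices. $G^r(m,l)$ is the set of pairs $(\Theta,\beta)$ with $\Theta\in G(m,l)$ and $\beta$ an $r$-component of $\Theta$. Place the $n$-gon centered at the origin; $\rho$ is the rotation $v\mapsto [v+1]_n$. The central polygon of a dissection is the diagonal through the origin (as a 2-gon) if there is one, and otherwise the face containing the origin in its interior. $G_m(n,k;\rho^j)$ is the set of $k$-dissections of the $n$-gon invariant under $\rho^j$ whose central polygon has $m$ vertices. $\delta_{r2}$ is the Kronecker delta. *)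

theory Defs
  imports "HOL-Analysis.Analysis"
begin

text \<open>
  Vertices are labels in \<open>{..<m}\<close>; an edge is the set of its two end labels, and a face is
  represented by the set of labels of its vertices (which determines it, faces being convex).
\<close>

definition vertex :: "nat \<Rightarrow> nat \<Rightarrow> complex" where
  "vertex m v = cis (2 * pi * real v / real m)"

definition polygon :: "nat \<Rightarrow> complex set" where
  "polygon m = convex hull (vertex m ` {..<m})"

definition chord :: "nat \<Rightarrow> nat set \<Rightarrow> complex set" where
  "chord m D = convex hull (vertex m ` D)"

definition sides :: "nat \<Rightarrow> nat set set" where
  "sides m = {{v, (v + 1) mod m} | v. v < m}"

definition diagonals :: "nat \<Rightarrow> nat set set" where
  "diagonals m = {{a, b} | a b. a < m \<and> b < m \<and> a \<noteq> b} - sides m"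

definition crossing :: "nat \<Rightarrow> nat set \<Rightarrow> nat set \<Rightarrow> bool" where
  "crossing m D E \<longleftrightarrow> rel_interior (chord m D) \<inter> rel_interior (chord m E) \<noteq> {}"

definition is_dissection :: "nat \<Rightarrow> nat set set \<Rightarrow> bool" where
  "is_dissection m \<Theta> \<longleftrightarrow>
     \<Theta> \<subseteq> diagonals m \<and> (\<forall>D\<in>\<Theta>. \<forall>E\<in>\<Theta>. D \<noteq> E \<longrightarrow> \<not> crossing m D E)"

text \<open>
  The number of diagonals is a real parameter, so that the set is empty
  unless it is a nonnegative integer.
\<close>

definition dissections :: "nat \<Rightarrow> real \<Rightarrow> nat set set set" where
  "dissections m l = {\<Theta>. is_dissection m \<Theta> \<and> real (card \<Theta>) = l}"

definition regions :: "nat \<Rightarrow> nat set set \<Rightarrow> complex set set" where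
  "regions m \<Theta> = components (interior (polygon m) - (\<Union>D\<in>\<Theta>. chord m D))"

definition corners :: "nat \<Rightarrow> complex set \<Rightarrow> nat set" where
  "corners m F = {v. v < m \<and> vertex m v \<in> closure F}"

definition faces :: "nat \<Rightarrow> nat set set \<Rightarrow> nat set set" where
  "faces m \<Theta> = corners m ` regions m \<Theta>"

definition r_components :: "nat \<Rightarrow> nat \<Rightarrow> nat set set \<Rightarrow> nat set set" where
  "r_components r m \<Theta> =
     (if r = 2 then sides m \<union> \<Theta>
      else if r \<ge> 3 then {S \<in> faces m \<Theta>. card S = r}
      else {})"

definition pointed_dissections :: "nat \<Rightarrow> nat \<Rightarrow> real \<Rightarrow> (nat set set \<times> nat set) set" where
  "pointed_dissections r m l =
     {(\<Theta>, \<beta>). \<Theta> \<in> dissections m l \<and> \<beta> \<in> r_components r m \<Theta>}"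

definition rotation :: "nat \<Rightarrow> nat \<Rightarrow> nat" where
  "rotation n v = (v + 1) mod n"

definition invariant_under :: "(nat \<Rightarrow> nat) \<Rightarrow> nat set set \<Rightarrow> bool" where
  "invariant_under g \<Theta> \<longleftrightarrow> (\<lambda>D. g ` D) ` \<Theta> = \<Theta>"

definition central_polygon :: "nat \<Rightarrow> nat set set \<Rightarrow> nat set" where
  "central_polygon n \<Theta> =
     (if \<exists>D\<in>\<Theta>. 0 \<in> chord n D then THE D. D \<in> \<Theta> \<and> 0 \<in> chord n D
      else corners n (THE F. F \<in> regions n \<Theta> \<and> 0 \<in> F))"

definition invariant_dissections ::
    "nat \<Rightarrow> nat \<Rightarrow> nat \<Rightarrow> (nat \<Rightarrow> nat) \<Rightarrow> nat set set set" where
  "invariant_dissections m n k g =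
     {\<Theta> \<in> dissections n (real k). invariant_under g \<Theta> \<and> card (central_polygon n \<Theta>) = m}"

end

theory Submission
  imports Defs
begin

text \<open>
  Both sets are put in bijection with sets of \<open>j\<close>-periodic, pairwise noncrossing arcs \<open>(x, y)\<close> on the
  integers with \<open>2 \<le> y - x < j\<close>. A \<open>\<rho>\<^sup>j\<close>-invariant dissection of the \<open>n\<close>-gon without a diameter is
  lifted by unrolling the circle modulo \<open>n\<close> and orienting each diagonal so that its arc faces away
  from the center: noncrossing with its own rotated copies bounds the arc by \<open>j\<close>, and length exactly
  \<open>j\<close> would leave a central polygon with only \<open>d\<close> vertices. The central polygon consists of the points
  strictly under no arc. Reading the same arcs modulo \<open>j\<close> gives a dissection of the \<open>j\<close>-gon in which
  the \<open>r\<close> uncovered points form a component \<open>\<beta>\<close>; conversely, \<open>\<beta>\<close> tells how to orient each diagonal,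
  namely away from \<open>\<beta>\<close>. If \<open>r = 2\<close>, the two sides of the digon \<open>\<beta>\<close> are two arcs with the same image
  (one of them trivial when \<open>\<beta>\<close> is a side of the \<open>j\<close>-gon), which explains the Kronecker delta.
\<close>

section \<open>Chords as pairs of integers\<close>

text \<open>The obstacle is that faces and the central polygon are defined topologically, through
  components of the polygon minus its chords, while the bijection only moves labels. The bridge is
  the sign of \<open>orient\<close>: a region is the set of interior points with one prescribed sign
  for each diagonal, so it is convex, and its corners are the vertices meeting the weak
  inequalities. From there on only the order of integers matters. The bound \<open>j\<close> does
  double duty. Since \<open>j \<le> n / 2\<close>, an arc shorter than \<open>j\<close> is never
  confused with its complement modulo \<open>n\<close>, so the length alone fixes the direction.
  Modulo \<open>j\<close> this is lost, and the component has to supply it. An arc of length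
  \<open>j - 1\<close> is a diagonal modulo \<open>n\<close> but the long way round a side modulo
  \<open>j\<close>; only there do the edges of the arcs leave the set of diagonals. Each arc modulo
  \<open>j\<close> gives \<open>d\<close> diagonals of the \<open>n\<close>-gon, so
  \<open>k / d\<close> counts arcs modulo \<open>j\<close>.\<close>

lemma mod_eq_imp_eq:
  fixes a b m :: int
  assumes "a mod m = b mod m" "a - b < m" "b - a < m"
  shows "a = b"
proof -
  have "m dvd a - b" using assms(1) by (simp add: mod_eq_dvd_iff)
  then have "\<bar>a - b\<bar> < m \<Longrightarrow> a - b = 0"
    using dvd_imp_le_int[of "a - b" m] by fastforce
  then show ?thesis using assms(2,3) by linarith
qed

text \<open>Integer endpoints let \<open>x < y < x + m\<close> record a chord together with one of
  its two sides; \<open>edge_swap\<close> passes to the other side.\<close>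

definition edge :: "nat \<Rightarrow> int \<Rightarrow> int \<Rightarrow> nat set" where
  "edge m x y = {nat (x mod int m), nat (y mod int m)}"

lemma edge_eq_iff:
  assumes "m > 0"
  shows "edge m x y = edge m u v \<longleftrightarrow>
    (x mod int m = u mod int m \<and> y mod int m = v mod int m) \<or>
    (x mod int m = v mod int m \<and> y mod int m = u mod int m)"
  using assms by (simp add: edge_def doubleton_eq_iff eq_nat_nat_iff)

lemma edge_commute: "edge m x y = edge m y x"
  by (auto simp: edge_def)

lemma edge_shift: "edge m (x + k * int m) (y + k * int m) = edge m x y"
  by (simp add: edge_def)

lemma edge_shift_right: "edge m x (y + int m) = edge m x y"
  by (simp add: edge_def)

lemma edge_swap: "edge m y (x + int m) = edge m x y"
  by (auto simp: edge_def)

lemma lift_exists: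
  fixes w :: int
  assumes "m > 0"
  obtains x where "w \<le> x" "x < w + m" "x mod m = z mod m"
proof
  show "w \<le> w + (z - w) mod m" "w + (z - w) mod m < w + m" "(w + (z - w) mod m) mod m = z mod m"
    using assms by (auto simp: mod_simps)
qed

text \<open>The start \<open>w\<close> of the window is free so that a chord can be lifted relative
  to a given point: that point is then the first endpoint or lies outside the lifted arc.\<close>

lemma pair_lift:
  fixes w :: int
  assumes "a < m" "b < m" "a \<noteq> b"
  obtains x y where "w \<le> x" "x < y" "y < w + int m" "{a, b} = edge m x y"
proof -
  have m: "int m > 0" using assms by simp
  obtain x where x: "w \<le> x" "x < w + int m" "x mod int m = int a mod int m"
    using lift_exists[OF m] by metis
  obtain y where y: "w \<le> y" "y < w + int m" "y mod int m = int b mod int m"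
    using lift_exists[OF m] by metis
  have e: "edge m x y = {a, b}" using x y assms by (simp add: edge_def)
  have "x \<noteq> y" using x y assms by auto
  then consider "x < y" | "y < x" by linarith
  then show ?thesis
    using that[of x y] that[of y x] x y e edge_commute by metis
qed

lemma edge_in_sides_iff:
  assumes "m \<ge> 3" "x < y" "y < x + int m"
  shows "edge m x y \<in> sides m \<longleftrightarrow> y = x + 1 \<or> y = x + int m - 1"
proof
  assume "edge m x y \<in> sides m"
  then obtain v where v: "v < m" "edge m x y = {v, (v + 1) mod m}"
    by (auto simp: sides_def)
  have "{v, (v + 1) mod m} = edge m (int v) (int v + 1)"
    using v(1) assms by (simp add: edge_def nat_mod_distrib nat_add_distrib)
  then have "edge m x y = edge m (int v) (int v + 1)" using v by simp
  then consider "x mod int m = int v mod int m" "y mod int m = (int v + 1) mod int m"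
    | "x mod int m = (int v + 1) mod int m" "y mod int m = int v mod int m"
    using assms by (auto simp: edge_eq_iff)
  then show "y = x + 1 \<or> y = x + int m - 1"
  proof cases
    case 1
    then have "y mod int m = (x + 1) mod int m" by (metis mod_add_left_eq)
    from mod_eq_imp_eq[OF this] show ?thesis using assms by linarith
  next
    case 2
    then have "x mod int m = (y + 1) mod int m" by (metis mod_add_left_eq)
    then have "(x + int m) mod int m = (y + 1) mod int m" by simp
    from mod_eq_imp_eq[OF this] show ?thesis using assms by linarith
  qed
next
  have *: "edge m x (x + 1) \<in> sides m" for x
  proof -
    define v where "v = nat (x mod int m)"
    have v: "x mod int m = int v" using assms(1) by (simp add: v_def)
    have "(x + 1) mod int m = int ((v + 1) mod m)"
      using v mod_add_left_eq[of x "int m" 1] by (simp add: zmod_int add.commute)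
    then have "edge m x (x + 1) = {nat (x mod int m), (nat (x mod int m) + 1) mod m}"
      by (simp add: edge_def v del: of_nat_mod)
    moreover have "nat (x mod int m) < m" using assms(1) by (simp add: nat_less_iff)
    ultimately show ?thesis unfolding sides_def by blast
  qed
  assume "y = x + 1 \<or> y = x + int m - 1"
  then show "edge m x y \<in> sides m"
  proof
    assume y: "y = x + int m - 1"
    have "edge m x y = edge m (x - 1) (x - 1 + 1)"
      using edge_shift_right[of m x "x - 1"] edge_commute y by (metis add_diff_eq diff_add_cancel add.commute)
    then show ?thesis using * by metis
  qed (use * in auto)
qed

lemma edge_in_diagonals_iff:
  assumes "m \<ge> 3" "x < y" "y < x + int m"
  shows "edge m x y \<in> diagonals m \<longleftrightarrow> x + 2 \<le> y \<and> y \<le> x + int m - 2"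
proof -
  have "x mod int m \<noteq> y mod int m" using mod_eq_imp_eq[of x "int m" y] assms by linarith
  then have "nat (x mod int m) \<noteq> nat (y mod int m)" using assms by (simp add: eq_nat_nat_iff)
  moreover have "nat (x mod int m) < m" "nat (y mod int m) < m"
    using assms by (auto simp: nat_less_iff)
  ultimately have "edge m x y \<in> {{a, b} |a b. a < m \<and> b < m \<and> a \<noteq> b}"
    unfolding edge_def by blast
  then show ?thesis
    unfolding diagonals_def using edge_in_sides_iff[OF assms] assms by auto
qed

lemma diagonal_lift:
  assumes "D \<in> diagonals m"
  obtains x y where "w \<le> x" "x < y" "y < w + int m" "D = edge m x y"
proof -
  obtain a b where "a < m" "b < m" "a \<noteq> b" "D = {a, b}"
    using assms by (auto simp: diagonals_def)
  then show ?thesis using pair_lift that by metis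
qed

section \<open>Geometry of the regular polygon\<close>

definition pt :: "nat \<Rightarrow> int \<Rightarrow> complex" where
  "pt m x = cis (2 * pi * of_int x / of_nat m)"

lemma pt_shift: assumes "m > 0" shows "pt m (x + k * int m) = pt m x"
proof -
  have "2 * pi * of_int (x + k * int m) / of_nat m = 2 * pi * of_int x / of_nat m + 2 * pi * of_int k"
    using assms by (simp add: field_simps)
  then show ?thesis unfolding pt_def
    by (simp add: cis_multiple_2pi flip: cis_mult)
qed

lemma vertex_nat_mod: assumes "m > 0" shows "vertex m (nat (x mod int m)) = pt m x"
proof -
  have "vertex m (nat (x mod int m)) = pt m (x mod int m)"
    using assms by (simp add: vertex_def pt_def)
  also have "\<dots> = pt m (x mod int m + (x div int m) * int m)"
    by (rule pt_shift[OF assms, symmetric])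
  finally show ?thesis by simp
qed

lemma vertex_eq_pt: "vertex m v = pt m (int v)"
  by (simp add: vertex_def pt_def)

lemma norm_pt: "norm (pt m x) = 1"
  by (simp add: pt_def)

text \<open>Twice the signed area of the triangle \<open>a b c\<close>.\<close>

definition orient :: "complex \<Rightarrow> complex \<Rightarrow> complex \<Rightarrow> real" where
  "orient a b c = Im (cnj (b - a) * (c - a))"

lemma orient_swap: "orient a c b = - orient a b c"
  by (simp add: orient_def algebra_simps)

lemma orient_rotate: "orient b c a = orient a b c"
  by (simp add: orient_def algebra_simps)

lemma orient_same: "orient a b a = 0" "orient a b b = 0"
  by (simp_all add: orient_def algebra_simps)

lemma orient_affine:
  "orient a b ((1 - t) *\<^sub>R c + t *\<^sub>R d) = (1 - t) * orient a b c + t * orient a b d"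
  by (simp add: orient_def algebra_simps)

lemma continuous_on_orient: "continuous_on S (orient a b)"
  unfolding orient_def by (intro continuous_intros)

text \<open>On the unit circle the area factors into sines of half angles, so its sign can be read
  off factor by factor.\<close>

lemma orient_cis:
  "orient (cis a) (cis b) (cis c) = 4 * sin ((b - a) / 2) * sin ((c - b) / 2) * sin ((c - a) / 2)"
proof -
  define u v where "u = (b - a) / 2" and "v = (c - b) / 2"
  have bc: "b = a + 2 * u" "c = b + 2 * v" "(c - a) / 2 = u + v"
    by (auto simp: u_def v_def field_simps)
  have "orient (cis a) (cis b) (cis c) = sin (b - a) + sin (c - b) - sin (c - a)"
    by (simp add: orient_def sin_diff algebra_simps)
  also have "\<dots> = sin (2 * u) + sin (2 * v) - sin (2 * (u + v))"
  proof -
    have "2 * (u + v) = c - a" "2 * u = b - a" "2 * v = c - b" by (simp_all add: u_def v_def field_simps)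
    then show ?thesis by simp
  qed
  also have "\<dots> = 4 * sin u * sin v * sin (u + v)"
  proof -
    have "sin (2 * u) + sin (2 * v) - sin (2 * (u + v)) - 4 * sin u * sin v * sin (u + v) =
        2 * sin u * cos u * (1 - ((sin v)\<^sup>2 + (cos v)\<^sup>2)) +
        2 * sin v * cos v * (1 - ((sin u)\<^sup>2 + (cos u)\<^sup>2))"
      unfolding sin_double sin_add cos_add by (simp only: algebra_simps power2_eq_square)
    then show ?thesis by simp
  qed
  finally show ?thesis by (simp only: bc(3) flip: u_def v_def)
qed

text \<open>Each half angle in \<open>orient_cis\<close> is \<open>pi * (b - a) / m\<close> with
  \<open>0 < b - a < m\<close>, hence lies strictly between 0 and pi.\<close>

lemma orient_pt_pos:
  assumes "x < y" "y < z" "z < x + int m"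
  shows "orient (pt m x) (pt m y) (pt m z) > 0"
proof -
  have *: "sin ((2 * pi * of_int b / of_nat m - 2 * pi * of_int a / of_nat m) / 2) > 0"
    if "a < b" "b < a + int m" for a b :: int
  proof -
    have m: "real m > 0" using that by (cases m) auto
    have eq: "(2 * pi * of_int b / of_nat m - 2 * pi * of_int a / of_nat m) / 2
        = pi * (of_int (b - a) / of_nat m)"
      using m by (simp add: field_simps)
    have "of_int (b - a) < real m" using that by linarith
    then have "of_int (b - a) / real m < 1" "of_int (b - a) / real m > 0"
      using m that by simp_all
    then have "pi * (of_int (b - a) / real m) < pi * 1" "0 < pi * (of_int (b - a) / real m)"
      by (simp_all only: mult_less_cancel_left_pos pi_gt_zero mult_pos_pos)
    then show ?thesis unfolding eq by (intro sin_gt_zero) simp_all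
  qed
  show ?thesis unfolding pt_def orient_cis
    by (intro mult_pos_pos *) (use assms in auto)
qed

lemma orient_pt_neg:
  assumes "x < z" "z < y" "y < x + int m"
  shows "orient (pt m x) (pt m y) (pt m z) < 0"
  using orient_pt_pos[OF assms] orient_swap[of "pt m x" "pt m z" "pt m y"] by linarith

text \<open>With \<open>q = (1 - t) a + t b\<close> and unit \<open>a\<close>, \<open>b\<close>, the
  squared norm of \<open>q\<close> is \<open>1 - t (1 - t) |a - b|^2\<close>. Staying in the unit
  disk thus forces \<open>t\<close> into the unit interval. This allows chords to be replaced by
  their lines.\<close>

lemma on_line_in_segment:
  assumes "norm a = 1" "norm b = 1" "a \<noteq> b" "norm q \<le> 1" "orient a b q = 0"
  shows "q \<in> closed_segment a b"
proof -
  define t where "t = Re ((q - a) / (b - a))"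
  have "Im ((q - a) / (b - a)) = 0"
  proof -
    have "(q - a) / (b - a) = (cnj (b - a) * (q - a)) / (cmod (b - a))\<^sup>2"
      by (simp add: complex_div_cnj[of "q - a"] mult.commute)
    then show ?thesis using assms(5) unfolding orient_def by (simp add: Im_divide_of_real)
  qed
  then have "(q - a) / (b - a) = of_real t" by (simp add: t_def complex_eq_iff)
  then have "q - a = of_real t * (b - a)" using assms(3) by (simp add: divide_eq_eq)
  then have q: "q = (1 - t) *\<^sub>R a + t *\<^sub>R b" by (simp add: scaleR_conv_of_real algebra_simps)
  have "(norm q)\<^sup>2 = 1 - t * (1 - t) * (norm (a - b))\<^sup>2"
  proof -
    have "(Re a)\<^sup>2 + (Im a)\<^sup>2 = 1" "(Re b)\<^sup>2 + (Im b)\<^sup>2 = 1"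
      using assms(1,2) by (simp_all flip: cmod_power2)
    then show ?thesis unfolding q cmod_power2 by (simp; algebra)
  qed
  moreover have "(norm q)\<^sup>2 \<le> 1" using assms(4) by (simp add: power_le_one)
  ultimately have "t * (1 - t) * (norm (a - b))\<^sup>2 \<ge> 0" by linarith
  moreover have "(norm (a - b))\<^sup>2 > 0" using assms(3) by simp
  ultimately have "t * (1 - t) \<ge> 0" by (simp add: zero_le_mult_iff)
  then have "0 \<le> t" "t \<le> 1" by (auto simp: zero_le_mult_iff)
  then show ?thesis using q by (auto simp: closed_segment_def)
qed

lemma orient_eq_0_on_segment:
  assumes "q \<in> closed_segment a b" shows "orient a b q = 0"
  using assms by (auto simp: closed_segment_def orient_affine orient_same)

section \<open>Crossing chords as interlacing endpoints\<close>

lemma chord_edge: "m > 0 \<Longrightarrow> chord m (edge m x y) = closed_segment (pt m x) (pt m y)"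
  by (simp add: chord_def edge_def vertex_nat_mod segment_convex_hull)

lemma pt_neq:
  assumes "x < y" "y < x + int m" "m \<ge> 3" shows "pt m x \<noteq> pt m y"
proof (cases "y = x + 1")
  case True
  then show ?thesis using orient_pt_pos[of x y "x + 2" m] assms orient_same
    by (auto simp: orient_def)
next
  case False
  then show ?thesis using orient_pt_pos[of x "x + 1" y m] assms by (auto simp: orient_def)
qed

text \<open>The ends of the second chord lie strictly on opposite sides of the first, so it meets
  the line of the first in a point of the disk, hence on the first chord. That point is not an end
  of the first chord, because those ends lie off the line of the second.\<close>

lemma crossing_edge:
  assumes "x < x'" "x' < y" "y < y'" "y' < x + int m" "m \<ge> 3"
  shows "crossing m (edge m x y) (edge m x' y')"
proof -
  let ?a = "pt m x" and ?b = "pt m y" and ?c = "pt m x'" and ?d = "pt m y'"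
  have c: "orient ?a ?b ?c < 0" by (rule orient_pt_neg) (use assms in auto)
  have d: "orient ?a ?b ?d > 0" by (rule orient_pt_pos) (use assms in auto)
  \<comment> \<open>The parameter at which the affine function \<open>orient ?a ?b\<close> vanishes
    on the segment from \<open>?c\<close> to \<open>?d\<close>.\<close>
  define t where "t = - orient ?a ?b ?c / (orient ?a ?b ?d - orient ?a ?b ?c)"
  define e where "e = (1 - t) *\<^sub>R ?c + t *\<^sub>R ?d"
  have t: "0 < t" "t < 1" using c d by (auto simp: t_def field_simps)
  have e0: "orient ?a ?b e = 0" unfolding e_def orient_affine t_def using c d by (simp add: field_simps)
  have "?c \<noteq> ?d" using c d by auto
  then have ecd: "e \<in> open_segment ?c ?d" using t by (auto simp: e_def in_segment)
  have "e \<in> cball 0 1"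
    using ecd closed_segment_subset[of ?c "cball 0 1" ?d] segment_open_subset_closed norm_pt
    by (auto simp: subset_eq)
  then have "e \<in> closed_segment ?a ?b"
    using e0 pt_neq[of x y m] assms by (intro on_line_in_segment) (auto simp: norm_pt)
  moreover have "orient ?c ?d e = 0"
    using ecd segment_open_subset_closed by (blast intro: orient_eq_0_on_segment)
  moreover have "orient ?c ?d ?a > 0"
    using orient_pt_pos[of x x' y' m] assms orient_rotate[of ?c ?d ?a] by simp
  moreover have "orient ?c ?d ?b < 0"
    using orient_pt_neg[of x' y y' m] assms by simp
  ultimately have "e \<in> open_segment ?a ?b" by (auto simp: open_segment_def)
  then show ?thesis
    using ecd assms pt_neq[of x y m] pt_neq[of x' y' m]
    by (auto simp: crossing_def chord_edge rel_interior_closed_segment)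
qed

lemma open_segment_orient_neg:
  assumes "orient a b c \<le> 0" "orient a b d \<le> 0" "orient a b c < 0 \<or> orient a b d < 0"
    and "e \<in> open_segment c d"
  shows "orient a b e < 0"
proof -
  obtain t where t: "0 < t" "t < 1" "e = (1 - t) *\<^sub>R c + t *\<^sub>R d"
    using assms(4) by (auto simp: in_segment)
  have "(1 - t) * orient a b c + t * orient a b d < 0"
  proof (cases "orient a b c < 0")
    case True
    then have "(1 - t) * orient a b c < 0" "t * orient a b d \<le> 0"
      using t assms by (auto simp: mult_pos_neg mult_nonneg_nonpos)
    then show ?thesis by linarith
  next
    case False
    then have "(1 - t) * orient a b c \<le> 0" "t * orient a b d < 0"
      using t assms by (auto simp: mult_pos_neg mult_nonneg_nonpos)
    then show ?thesis by linarith
  qed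
  then show ?thesis using t by (simp add: orient_affine)
qed

text \<open>Unless the ends interlace, \<open>u\<close> and \<open>v\<close> are on the same closed
  side of the line through \<open>x\<close> and \<open>y\<close>, and not both on it because the
  edges differ. The open second chord then misses the line. With \<open>x\<close> as the first
  label, only one order of interlacing is possible.\<close>

lemma crossing_edgeD:
  assumes "crossing m (edge m x y) (edge m u v)" "m \<ge> 3"
    and "x < y" "y < x + int m" "x \<le> u" "u < v" "v < x + int m"
    and "edge m x y \<noteq> edge m u v"
  shows "(x < u \<and> u < y \<and> y < v)"
proof (rule ccontr)
  assume n: "\<not> ?thesis"
  have "\<not> (u = x \<and> v = y)" using assms(8) by auto
  then consider "u \<le> y \<and> v \<le> y \<and> (u \<noteq> x \<or> v \<noteq> y)" | "u = x \<or> u \<ge> y" "v > y" using n assms by linarith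
  note cs = this
  let ?o = "orient (pt m x) (pt m y)"
  obtain e where "e \<in> rel_interior (chord m (edge m x y))" "e \<in> rel_interior (chord m (edge m u v))"
    using assms(1) by (auto simp: crossing_def)
  then have e: "e \<in> closed_segment (pt m x) (pt m y)" "e \<in> open_segment (pt m u) (pt m v)"
    using assms(2-7) pt_neq[of u v m] rel_interior_subset[of "chord m (edge m x y)"]
    by (auto simp: chord_edge rel_interior_closed_segment)
  have e0: "?o e = 0" using e(1) by (rule orient_eq_0_on_segment)
  show False
    using cs
  proof cases
    case 1
    have *: "?o (pt m z) \<le> 0" "z \<noteq> x \<Longrightarrow> z \<noteq> y \<Longrightarrow> ?o (pt m z) < 0" if "x \<le> z" "z \<le> y" for z
      using orient_pt_neg[of x z y m] that assms orient_same
      by (cases "z = x \<or> z = y"; fastforce)+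
    have "?o e < 0"
      using 1 assms *[of u] *[of v]
      by (intro open_segment_orient_neg[OF _ _ _ e(2)]) auto
    then show False using e0 by simp
  next
    case 2
    let ?p = "orient (pt m y) (pt m x)"
    have op: "?p z = - ?o z" for z by (simp add: orient_def algebra_simps)
    have *: "?o (pt m z) \<ge> 0" "z \<noteq> x \<Longrightarrow> z \<noteq> y \<Longrightarrow> ?o (pt m z) > 0" if "z = x \<or> z \<ge> y" "z < x + int m" for z
      using orient_pt_pos[of x y z m] that assms orient_same
      by (cases "z = x \<or> z = y"; fastforce)+
    have "?p e < 0"
      using 2 assms *[of u] *[of v]
      by (intro open_segment_orient_neg[OF _ _ _ e(2)]) (auto simp: op)
    then show False using e0 by (simp add: op)
  qed
qed

text \<open>Because the integers range over all lifts, a single interlacing pattern suffices: the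
  second chord can always be lifted to the window that starts at \<open>x\<close>.\<close>

lemma is_dissection_iff:
  assumes "m \<ge> 3"
  shows "is_dissection m \<Theta> \<longleftrightarrow> \<Theta> \<subseteq> diagonals m \<and>
    (\<forall>x x' y y'. x < x' \<longrightarrow> x' < y \<longrightarrow> y < y' \<longrightarrow> y' < x + int m \<longrightarrow>
       edge m x y \<in> \<Theta> \<longrightarrow> edge m x' y' \<notin> \<Theta>)" (is "_ \<longleftrightarrow> _ \<and> ?N")
proof (intro iffI conjI)
  assume d: "is_dissection m \<Theta>"
  show "\<Theta> \<subseteq> diagonals m" using d by (simp add: is_dissection_def)
  show ?N
  proof (intro allI impI notI)
    fix x x' y y' assume a: "x < x'" "x' < y" "y < y'" "y' < x + int m" "edge m x y \<in> \<Theta>" "edge m x' y' \<in> \<Theta>"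
    have "edge m x y \<noteq> edge m x' y'"
      using mod_eq_imp_eq[of x "int m" x'] mod_eq_imp_eq[of x "int m" y'] a assms
      by (auto simp: edge_eq_iff)
    then show False using d a crossing_edge[OF a(1-4) assms] by (auto simp: is_dissection_def)
  qed
next
  assume r: "\<Theta> \<subseteq> diagonals m \<and> ?N"
  show "is_dissection m \<Theta>"
    unfolding is_dissection_def
  proof (intro conjI ballI impI notI)
    show "\<Theta> \<subseteq> diagonals m" using r by simp
    fix D E assume de: "D \<in> \<Theta>" "E \<in> \<Theta>" "D \<noteq> E" "crossing m D E"
    obtain x y where xy: "x < y" "y < 0 + int m" "0 \<le> x" "D = edge m x y"
      using diagonal_lift de(1) r by (metis subsetD)
    obtain u v where uv: "x \<le> u" "u < v" "v < x + int m" "E = edge m u v"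
      using diagonal_lift de(2) r by (metis subsetD)
    have "x < u \<and> u < y \<and> y < v"
      by (rule crossing_edgeD[of m x y u v]) (use de xy uv assms in auto)
    then show False using r uv xy de by blast
  qed
qed

section \<open>Regions and faces as sign patterns\<close>

lemma pt_cong: assumes "m > 0" "x mod int m = y mod int m" shows "pt m x = pt m y"
  using vertex_nat_mod assms by metis

lemma polygon_subset_cball: "polygon m \<subseteq> cball 0 1"
  unfolding polygon_def by (intro hull_minimal) (auto simp: vertex_eq_pt norm_pt)

lemma pt_in_polygon: "m > 0 \<Longrightarrow> pt m x \<in> polygon m"
  unfolding polygon_def vertex_nat_mod[symmetric]
  by (intro hull_inc) (auto simp: nat_less_iff)

text \<open>Reversing a chord flips both factors. Sides are therefore compared through products,
  which depend only on the unordered edge.\<close>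

lemma orient_product_cong:
  assumes "edge m x y = edge m u v" "m > 0"
  shows "orient (pt m x) (pt m y) p * orient (pt m x) (pt m y) q =
         orient (pt m u) (pt m v) p * orient (pt m u) (pt m v) q"
proof -
  have "orient b a z = - orient a b z" for a b z by (simp add: orient_def algebra_simps)
  moreover have "(pt m x = pt m u \<and> pt m y = pt m v) \<or> (pt m x = pt m v \<and> pt m y = pt m u)"
    using assms(1) unfolding edge_eq_iff[OF assms(2)]
    by (auto intro: pt_cong[OF assms(2)])
  ultimately show ?thesis by (metis minus_mult_minus)
qed

lemma pt_neq_of_diagonal:
  assumes "m \<ge> 3" "edge m x y \<in> diagonals m" shows "pt m x \<noteq> pt m y"
proof -
  have m: "int m > 0" using assms by simp
  obtain z where z: "x \<le> z" "z < x + int m" "z mod int m = y mod int m"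
    using lift_exists[OF m] by metis
  have "x mod int m \<noteq> y mod int m"
    using assms by (auto simp: diagonals_def edge_def doubleton_eq_iff)
  then have "x < z" using z by (cases "x = z") auto
  then have "pt m x \<noteq> pt m z" using z assms by (intro pt_neq)
  then show ?thesis using pt_cong[OF _ z(3)] m by simp
qed

text \<open>The polygon lies in the unit disk, where a chord and its line coincide by
  \<open>on_line_in_segment\<close>.\<close>

lemma orient_nonzero_iff:
  assumes "m \<ge> 3" "\<Theta> \<subseteq> diagonals m" "p \<in> interior (polygon m)"
  shows "p \<notin> (\<Union>D\<in>\<Theta>. chord m D) \<longleftrightarrow>
    (\<forall>x y. edge m x y \<in> \<Theta> \<longrightarrow> orient (pt m x) (pt m y) p \<noteq> 0)"
proof (intro iffI allI impI notI)
  fix x y assume a: "p \<notin> (\<Union>D\<in>\<Theta>. chord m D)" "edge m x y \<in> \<Theta>" "orient (pt m x) (pt m y) p = 0"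
  have "norm p \<le> 1" using assms(3) interior_subset polygon_subset_cball by fastforce
  then have "p \<in> closed_segment (pt m x) (pt m y)"
    using a pt_neq_of_diagonal[of m x y] assms by (intro on_line_in_segment) (auto simp: norm_pt)
  then show False using a assms by (auto simp: chord_edge)
next
  assume a: "\<forall>x y. edge m x y \<in> \<Theta> \<longrightarrow> orient (pt m x) (pt m y) p \<noteq> 0" "p \<in> (\<Union>D\<in>\<Theta>. chord m D)"
  then obtain D where D: "D \<in> \<Theta>" "p \<in> chord m D" by auto
  obtain x y where "D = edge m x y" using diagonal_lift[of D m 0] D assms by blast
  then show False using a D assms orient_eq_0_on_segment[of p "pt m x" "pt m y"]
    by (auto simp: chord_edge)
qed

definition same_side :: "nat \<Rightarrow> nat set set \<Rightarrow> complex \<Rightarrow> complex set" where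
  "same_side m \<Theta> p = {q \<in> interior (polygon m). \<forall>x y. edge m x y \<in> \<Theta> \<longrightarrow>
     orient (pt m x) (pt m y) p * orient (pt m x) (pt m y) q > 0}"

lemma convex_orient_pos: "convex {q. c * orient a b q > 0}"
proof (rule convexI, clarify)
  fix q r and u v :: real
  assume *: "c * orient a b q > 0" "c * orient a b r > 0" "0 \<le> u" "0 \<le> v" "u + v = 1"
  have u: "u = 1 - v" using * by simp
  have "c * orient a b (u *\<^sub>R q + v *\<^sub>R r) = u * (c * orient a b q) + v * (c * orient a b r)"
    unfolding u orient_affine by (simp add: algebra_simps)
  moreover have "\<dots> > 0"
    using * by (cases "u = 0") (auto intro!: add_pos_nonneg mult_pos_pos)
  ultimately show "c * orient a b (u *\<^sub>R q + v *\<^sub>R r) > 0" by simp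
qed

lemma convex_same_side: "convex (same_side m \<Theta> p)"
proof -
  have "same_side m \<Theta> p = interior (polygon m) \<inter>
    (\<Inter>(x, y)\<in>{(x, y). edge m x y \<in> \<Theta>}. {q. orient (pt m x) (pt m y) p * orient (pt m x) (pt m y) q > 0})"
    by (auto simp: same_side_def)
  also have "convex \<dots>"
    by (intro convex_Int convex_INT convex_interior)
      (auto simp: polygon_def convex_orient_pos)
  finally show ?thesis .
qed

text \<open>On a connected set avoiding the chords, \<open>orient\<close> is continuous without
  zeros and so keeps its sign. Conversely, the points with the signs of \<open>p\<close> form a
  convex, hence connected, set that avoids all chords.\<close>

lemma connected_component_same_side:
  assumes "m \<ge> 3" "\<Theta> \<subseteq> diagonals m"
    and p: "p \<in> interior (polygon m) - (\<Union>D\<in>\<Theta>. chord m D)"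
  shows "connected_component_set (interior (polygon m) - (\<Union>D\<in>\<Theta>. chord m D)) p = same_side m \<Theta> p"
    (is "connected_component_set ?S p = _")
proof (intro equalityI subsetI)
  have nz: "orient (pt m x) (pt m y) q \<noteq> 0" if "q \<in> ?S" "edge m x y \<in> \<Theta>" for q x y
    using orient_nonzero_iff[OF assms(1,2), of q] that by auto
  {
    fix q assume "q \<in> connected_component_set ?S p"
    then obtain T where T: "connected T" "T \<subseteq> ?S" "p \<in> T" "q \<in> T"
      by (auto simp: connected_component_def)
    have "orient (pt m x) (pt m y) p * orient (pt m x) (pt m y) q > 0" if e: "edge m x y \<in> \<Theta>" for x y
    proof (rule ccontr)
      let ?o = "orient (pt m x) (pt m y)"
      assume "\<not> ?thesis"
      moreover have "?o p \<noteq> 0" "?o q \<noteq> 0" using nz T e by blast+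
      ultimately have "(?o p < 0 \<and> ?o q > 0) \<or> (?o q < 0 \<and> ?o p > 0)"
        by (metis linorder_neqE_linordered_idom mult_neg_neg mult_pos_pos)
      moreover have "connected (?o ` T)" using T continuous_on_orient by (intro connected_continuous_image)
      ultimately have "0 \<in> ?o ` T"
        using T connectedD_interval[of "?o ` T" "?o p" "?o q" 0]
          connectedD_interval[of "?o ` T" "?o q" "?o p" 0] by (auto simp: less_imp_le)
      then show False using nz T e by (metis imageE subsetD)
    qed
    then show "q \<in> same_side m \<Theta> p" using T by (auto simp: same_side_def)
  }
  fix q assume q: "q \<in> same_side m \<Theta> p"
  have "same_side m \<Theta> p \<subseteq> ?S"
  proof
    fix z assume z: "z \<in> same_side m \<Theta> p"
    then have "z \<in> interior (polygon m)" by (simp add: same_side_def)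
    moreover have "orient (pt m x) (pt m y) z \<noteq> 0" if "edge m x y \<in> \<Theta>" for x y
    proof -
      have "orient (pt m x) (pt m y) p * orient (pt m x) (pt m y) z > 0"
        using z that unfolding same_side_def by blast
      then show ?thesis by auto
    qed
    ultimately show "z \<in> ?S" using orient_nonzero_iff[OF assms(1,2), of z] by blast
  qed
  moreover have "p \<in> same_side m \<Theta> p"
  proof -
    have "w * w > 0" if "w \<noteq> 0" for w :: real using that by (auto simp: zero_less_mult_iff)
    then show ?thesis using p nz[OF p] by (simp add: same_side_def)
  qed
  ultimately show "q \<in> connected_component_set ?S p"
    using convex_connected[OF convex_same_side] q unfolding connected_component_def by blast
qed

text \<open>Passing to the closure weakens the strict inequalities. Conversely, a vertex satisfying
  the weak ones is a limit of points on its segment to \<open>p\<close>, where the strict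
  contribution of \<open>p\<close> restores strictness.\<close>

lemma corners_same_side:
  assumes "m \<ge> 3" "\<Theta> \<subseteq> diagonals m"
    and p: "p \<in> interior (polygon m) - (\<Union>D\<in>\<Theta>. chord m D)"
  shows "corners m (same_side m \<Theta> p) = {v. v < m \<and> (\<forall>x y. edge m x y \<in> \<Theta> \<longrightarrow>
     orient (pt m x) (pt m y) p * orient (pt m x) (pt m y) (pt m (int v)) \<ge> 0)}"
proof (rule set_eqI, unfold corners_def vertex_eq_pt mem_Collect_eq, intro conj_cong refl iffI allI impI)
  fix v x y
  assume v: "pt m (int v) \<in> closure (same_side m \<Theta> p)" "edge m x y \<in> \<Theta>"
  let ?o = "orient (pt m x) (pt m y)"
  have "closed {q. ?o p * ?o q \<ge> 0}"
    unfolding orient_def by (intro closed_Collect_le continuous_intros)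
  moreover have "same_side m \<Theta> p \<subseteq> {q. ?o p * ?o q \<ge> 0}"
    using v by (auto simp: same_side_def less_imp_le)
  ultimately have "closure (same_side m \<Theta> p) \<subseteq> {q. ?o p * ?o q \<ge> 0}"
    by (rule closure_minimal[rotated])
  then show "?o p * ?o (pt m (int v)) \<ge> 0" using v by auto
next
  fix v
  let ?V = "pt m (int v)"
  assume v: "\<forall>x y. edge m x y \<in> \<Theta> \<longrightarrow>
     orient (pt m x) (pt m y) p * orient (pt m x) (pt m y) ?V \<ge> 0"
  have nz: "orient (pt m x) (pt m y) p \<noteq> 0" if "edge m x y \<in> \<Theta>" for x y
    using orient_nonzero_iff[OF assms(1,2), of p] that p by auto
  \<comment> \<open>Points on the segment from \<open>p\<close> to the vertex that tend to the
    vertex; being pulled towards the interior point \<open>p\<close>, they stay in the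
    interior.\<close>
  define s where "s i = (1 - inverse (real (Suc i))) *\<^sub>R ?V + inverse (real (Suc i)) *\<^sub>R p" for i
  have "s i \<in> same_side m \<Theta> p" for i
  proof -
    define t where "t = inverse (real (Suc i))"
    have t: "0 < t" "t \<le> 1" by (auto simp: t_def field_simps)
    have si: "s i = (1 - t) *\<^sub>R ?V + t *\<^sub>R p" by (simp add: s_def t_def)
    have "?V - t *\<^sub>R (?V - p) \<in> interior (polygon m)"
      using p t assms(1) pt_in_polygon[of m]
      by (intro mem_interior_convex_shrink) (auto simp: polygon_def)
    then have "s i \<in> interior (polygon m)" by (simp add: si algebra_simps)
    moreover have "orient (pt m x) (pt m y) p * orient (pt m x) (pt m y) (s i) > 0"
      if e: "edge m x y \<in> \<Theta>" for x y
    proof -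
      let ?o = "orient (pt m x) (pt m y)"
      have "?o p * ?o (s i) = (1 - t) * (?o p * ?o ?V) + t * (?o p * ?o p)"
        unfolding si orient_affine by (simp add: algebra_simps)
      moreover have "(1 - t) * (?o p * ?o ?V) \<ge> 0" using v e t by simp
      moreover have "t * (?o p * ?o p) > 0"
        using t nz[OF e] by (auto simp: zero_less_mult_iff linorder_neq_iff)
      ultimately show ?thesis by linarith
    qed
    ultimately show ?thesis by (simp add: same_side_def)
  qed
  moreover have "s \<longlonglongrightarrow> (1 - 0) *\<^sub>R ?V + 0 *\<^sub>R p"
    unfolding s_def by (intro tendsto_intros LIMSEQ_inverse_real_of_nat)
  ultimately show "?V \<in> closure (same_side m \<Theta> p)"
    unfolding closure_sequential by auto
qed

lemma orient_avg3:
  "orient a b ((1/3) *\<^sub>R c + (1/3) *\<^sub>R d + (1/3) *\<^sub>R e) = (orient a b c + orient a b d + orient a b e) / 3"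
  by (simp add: orient_def field_simps)

lemma not_collinear_if_orient:
  assumes "orient a b c \<noteq> 0" shows "\<not> collinear {a, b, c}"
proof
  assume "collinear {a, b, c}"
  moreover have "a \<noteq> b" using assms by (auto simp: orient_def)
  ultimately have "c \<in> affine hull {a, b}" by (rule collinear_3_imp_in_affine_hull)
  then obtain u v where "c = u *\<^sub>R a + v *\<^sub>R b" "u + v = 1" by (auto simp: affine_hull_2)
  then have "c = (1 - v) *\<^sub>R a + v *\<^sub>R b" by (metis add_diff_cancel_right')
  then show False using assms by (simp add: orient_affine orient_same)
qed

lemma triangle_center_interior:
  assumes "x < y" "y < z" "z < x + int m"
  shows "(1/3) *\<^sub>R pt m x + (1/3) *\<^sub>R pt m y + (1/3) *\<^sub>R pt m z \<in> interior (polygon m)"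
proof -
  have m: "m > 0" using assms by (cases m) auto
  have "\<not> collinear {pt m x, pt m y, pt m z}"
    using orient_pt_pos[OF assms] by (intro not_collinear_if_orient) simp
  then have "interior (convex hull {pt m x, pt m y, pt m z}) =
    {v. \<exists>a b c. 0 < a \<and> 0 < b \<and> 0 < c \<and> a + b + c = 1 \<and> a *\<^sub>R pt m x + b *\<^sub>R pt m y + c *\<^sub>R pt m z = v}"
    by (intro interior_convex_hull_3_minimal) auto
  moreover have "0 < (1/3::real) \<and> (1/3) + (1/3) + (1/3) = (1::real)" by simp
  ultimately have "(1/3) *\<^sub>R pt m x + (1/3) *\<^sub>R pt m y + (1/3) *\<^sub>R pt m z \<in> interior (convex hull {pt m x, pt m y, pt m z})"
    by blast
  moreover have "convex hull {pt m x, pt m y, pt m z} \<subseteq> polygon m"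
    using pt_in_polygon[OF m] by (intro hull_minimal) (auto simp: polygon_def)
  ultimately show ?thesis using interior_mono by blast
qed

lemma orient_outside_arc:
  assumes "x < y" "y < x + int m" "v < m" "\<forall>z. x < z \<longrightarrow> z < y \<longrightarrow> nat (z mod int m) \<noteq> v"
  shows "orient (pt m x) (pt m y) (pt m (int v)) \<ge> 0"
    and "v \<notin> edge m x y \<Longrightarrow> orient (pt m x) (pt m y) (pt m (int v)) > 0"
proof -
  have m: "int m > 0" using assms by simp
  obtain z where z: "x \<le> z" "z < x + int m" "z mod int m = int v mod int m"
    using lift_exists[OF m] by metis
  have zv: "nat (z mod int m) = v" using z assms by simp
  have pz: "pt m (int v) = pt m z" using z m by (intro pt_cong) auto
  have "\<not> (x < z \<and> z < y)" using assms(4) zv by blast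
  then consider "z = x" | "z = y" | "y < z" using z by linarith
  note cs = this
  show "orient (pt m x) (pt m y) (pt m (int v)) \<ge> 0"
    using cs by cases (use assms z orient_pt_pos[of x y z m] in \<open>auto simp: pz orient_same\<close>)
  show "v \<notin> edge m x y \<Longrightarrow> orient (pt m x) (pt m y) (pt m (int v)) > 0"
    using cs by cases (use assms zv z orient_pt_pos[of x y z m] in \<open>auto simp: pz edge_def\<close>)
qed

text \<open>Phrased with labels instead of regions, so that it also makes sense when \<beta> is an
  edge, which bounds no region of its own.\<close>

definition splits_none :: "nat \<Rightarrow> nat set set \<Rightarrow> nat set \<Rightarrow> bool" where
  "splits_none m \<Theta> \<beta> \<longleftrightarrow> (\<forall>x y. x < y \<longrightarrow> y < x + int m \<longrightarrow> edge m x y \<in> \<Theta> \<longrightarrow>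
     (\<forall>z. x < z \<longrightarrow> z < y \<longrightarrow> nat (z mod int m) \<notin> \<beta>) \<or>
     (\<forall>z. y < z \<longrightarrow> z < x + int m \<longrightarrow> nat (z mod int m) \<notin> \<beta>))"

lemma card_ge_3_obtain:
  fixes S :: "nat set"
  assumes "card S \<ge> 3"
  obtains a b c where "a \<in> S" "b \<in> S" "c \<in> S" "a < b" "b < c"
proof -
  obtain T where T: "T \<subseteq> S" "card T = 3" "finite T" using assms by (meson obtain_subset_with_card_n)
  define xs where "xs = sorted_list_of_set T"
  have "length xs = 3" "sorted xs" "distinct xs" "set xs = T" using T by (auto simp: xs_def)
  then obtain a b c where "xs = [a, b, c]" by (auto simp: numeral_3_eq_3 length_Suc_conv)
  then show ?thesis using that[of a b c] T \<open>sorted xs\<close> \<open>distinct xs\<close> \<open>set xs = T\<close> by auto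
qed

text \<open>If a chord had labels of \<beta> strictly on both sides, \<open>orient\<close> would
  vanish at a point of the region; a label outside \<beta> is cut off from that point by some chord,
  whose far arc then misses \<beta> altogether. For the converse a point of the region has to be
  built from the labels of \<beta>.\<close>

lemma faces_iff:
  assumes m: "m \<ge> 3" and \<Theta>: "\<Theta> \<subseteq> diagonals m" and c3: "card \<beta> \<ge> 3"
  shows "\<beta> \<in> faces m \<Theta> \<longleftrightarrow> \<beta> \<subseteq> {..<m} \<and> splits_none m \<Theta> \<beta> \<and>
    (\<forall>z. nat (z mod int m) \<notin> \<beta> \<longrightarrow> (\<exists>x y. x < z \<and> z < y \<and> y < x + int m \<and> edge m x y \<in> \<Theta> \<and>
       (\<forall>w. x < w \<longrightarrow> w < y \<longrightarrow> nat (w mod int m) \<notin> \<beta>)))" (is "_ \<longleftrightarrow> ?R")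
proof
  have m0: "m > 0" using m by simp
  assume "\<beta> \<in> faces m \<Theta>"
  then obtain p where p: "p \<in> interior (polygon m) - (\<Union>D\<in>\<Theta>. chord m D)"
    and "\<beta> = corners m (connected_component_set (interior (polygon m) - (\<Union>D\<in>\<Theta>. chord m D)) p)"
    by (auto simp: faces_def regions_def components_def)
  then have \<beta>: "\<beta> = {v. v < m \<and> (\<forall>x y. edge m x y \<in> \<Theta> \<longrightarrow>
     orient (pt m x) (pt m y) p * orient (pt m x) (pt m y) (pt m (int v)) \<ge> 0)}"
    using connected_component_same_side[OF m \<Theta> p] corners_same_side[OF m \<Theta> p] by simp
  have in_\<beta>: "nat (z mod int m) \<in> \<beta> \<longleftrightarrow> (\<forall>x y. edge m x y \<in> \<Theta> \<longrightarrow>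
     orient (pt m x) (pt m y) p * orient (pt m x) (pt m y) (pt m z) \<ge> 0)" for z
  proof -
    have "pt m (int (nat (z mod int m))) = pt m z" using vertex_nat_mod[OF m0] vertex_eq_pt by metis
    then show ?thesis unfolding \<beta> using m0 by (auto simp: nat_less_iff)
  qed
  have nz: "orient (pt m x) (pt m y) p \<noteq> 0" if "edge m x y \<in> \<Theta>" for x y
    using orient_nonzero_iff[OF m \<Theta>, of p] that p by auto
  show ?R
  proof (intro conjI allI impI)
    show "\<beta> \<subseteq> {..<m}" by (auto simp: \<beta>)
    show "splits_none m \<Theta> \<beta>" unfolding splits_none_def
    proof (intro allI impI, rule ccontr)
      fix x y assume xy: "x < y" "y < x + int m" "edge m x y \<in> \<Theta>"
        and "\<not> ((\<forall>z. x < z \<longrightarrow> z < y \<longrightarrow> nat (z mod int m) \<notin> \<beta>) \<or>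
           (\<forall>z. y < z \<longrightarrow> z < x + int m \<longrightarrow> nat (z mod int m) \<notin> \<beta>))"
      then obtain z w where zw: "x < z" "z < y" "nat (z mod int m) \<in> \<beta>" "y < w" "w < x + int m"
        "nat (w mod int m) \<in> \<beta>" by blast
      let ?o = "orient (pt m x) (pt m y)"
      have "?o (pt m z) < 0" "?o (pt m w) > 0"
        using orient_pt_neg[of x z y m] orient_pt_pos[of x y w m] zw xy by auto
      moreover have "?o p * ?o (pt m z) \<ge> 0" "?o p * ?o (pt m w) \<ge> 0" using zw xy in_\<beta> by blast+
      ultimately have "?o p = 0" by (simp add: zero_le_mult_iff)
      then show False using nz xy by blast
    qed
    fix z assume "nat (z mod int m) \<notin> \<beta>"
    then obtain x0 y0 where xy0: "edge m x0 y0 \<in> \<Theta>"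
      "orient (pt m x0) (pt m y0) p * orient (pt m x0) (pt m y0) (pt m z) < 0"
      using in_\<beta> by (meson not_less)
    obtain x1 y1 where xy1: "z \<le> x1" "x1 < y1" "y1 < z + int m" "edge m x0 y0 = edge m x1 y1"
      using diagonal_lift xy0(1) \<Theta> by (metis subsetD)
    have "z \<noteq> x1"
      using xy0(2) xy1 orient_product_cong[OF xy1(4) m0, of p "pt m z"] by (auto simp: orient_same)
    \<comment> \<open>Moving the later end one turn down gives the complementary arc, the one that
      passes over \<open>z\<close>.\<close>
    define x where "x = y1 - int m"
    have e: "edge m x0 y0 = edge m x x1"
      using xy1(4) edge_swap[of m x1 x] edge_commute by (simp add: x_def)
    have xz: "x < z" "z < x1" "x1 < x + int m" using xy1 \<open>z \<noteq> x1\<close> by (auto simp: x_def)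
    let ?o = "orient (pt m x) (pt m x1)"
    have "?o p * ?o (pt m z) < 0" using xy0(2) orient_product_cong[OF e m0] by simp
    moreover have "?o (pt m z) < 0" using orient_pt_neg xz by blast
    ultimately have "?o p > 0" by (simp add: mult_less_0_iff)
    moreover have "?o (pt m w) < 0" if "x < w" "w < x1" for w using that orient_pt_neg xz by blast
    ultimately have "nat (w mod int m) \<notin> \<beta>" if "x < w" "w < x1" for w
      using that in_\<beta> e xy0(1) by (metis mult_pos_neg not_less)
    then show "\<exists>x y. x < z \<and> z < y \<and> y < x + int m \<and> edge m x y \<in> \<Theta> \<and>
       (\<forall>w. x < w \<longrightarrow> w < y \<longrightarrow> nat (w mod int m) \<notin> \<beta>)"
      using xz e xy0(1) by (intro exI[of _ x] exI[of _ x1]) auto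
  qed
next
  have m0: "m > 0" using m by simp
  assume r: ?R
  obtain a b c where abc: "a \<in> \<beta>" "b \<in> \<beta>" "c \<in> \<beta>" "a < b" "b < c"
    using card_ge_3_obtain[OF c3] by metis
  \<comment> \<open>A centroid of three labels of \<beta>: a chord ends in at most two of them, so
    the third puts the centroid strictly on the side of \<beta>.\<close>
  define p where "p = (1/3) *\<^sub>R pt m (int a) + (1/3) *\<^sub>R pt m (int b) + (1/3) *\<^sub>R pt m (int c)"
  have lt: "a < m" "b < m" "c < m" using abc r by auto
  have pint: "p \<in> interior (polygon m)"
    unfolding p_def using lt abc by (intro triangle_center_interior) auto
  have pos: "orient (pt m x) (pt m y) p > 0 \<and> (\<forall>v\<in>\<beta>. orient (pt m x) (pt m y) (pt m (int v)) \<ge> 0)"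
    if xy: "x < y" "y < x + int m" "\<forall>z. x < z \<longrightarrow> z < y \<longrightarrow> nat (z mod int m) \<notin> \<beta>" for x y
  proof -
    let ?o = "orient (pt m x) (pt m y)"
    have 1: "?o (pt m (int v)) \<ge> 0" if "v \<in> \<beta>" for v
      using orient_outside_arc(1)[of x y m v] xy r that by blast
    have 2: "?o (pt m (int v)) > 0" if "v \<in> \<beta>" "v \<notin> edge m x y" for v
      using orient_outside_arc(2)[of x y m v] xy r that by blast
    have "a \<notin> edge m x y \<or> b \<notin> edge m x y \<or> c \<notin> edge m x y"
      using abc by (auto simp: edge_def)
    then have "?o (pt m (int a)) + ?o (pt m (int b)) + ?o (pt m (int c)) > 0"
      using 1[OF abc(1)] 1[OF abc(2)] 1[OF abc(3)] 2[OF abc(1)] 2[OF abc(2)] 2[OF abc(3)]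
      by argo
    then show ?thesis using 1 by (simp add: p_def orient_avg3)
  qed
  have side: "orient (pt m x) (pt m y) p \<noteq> 0 \<and>
      (\<forall>v\<in>\<beta>. orient (pt m x) (pt m y) p * orient (pt m x) (pt m y) (pt m (int v)) \<ge> 0)"
    if e: "edge m x y \<in> \<Theta>" for x y
  proof -
    obtain x1 y1 where xy1: "0 \<le> x1" "x1 < y1" "y1 < 0 + int m" "edge m x y = edge m x1 y1"
      using diagonal_lift e \<Theta> by (metis subsetD)
    have lt1: "y1 < x1 + int m" using xy1 by simp
    have sp: "splits_none m \<Theta> \<beta>" using r by blast
    have "edge m x1 y1 \<in> \<Theta>" using e xy1 by simp
    then have cs: "(\<forall>z. x1 < z \<longrightarrow> z < y1 \<longrightarrow> nat (z mod int m) \<notin> \<beta>) \<or>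
           (\<forall>z. y1 < z \<longrightarrow> z < x1 + int m \<longrightarrow> nat (z mod int m) \<notin> \<beta>)"
      using sp xy1(2) lt1 unfolding splits_none_def by blast
    have "\<exists>u v. edge m x y = edge m u v \<and> orient (pt m u) (pt m v) p > 0 \<and>
        (\<forall>w\<in>\<beta>. orient (pt m u) (pt m v) (pt m (int w)) \<ge> 0)"
      using cs
    proof
      assume "\<forall>z. x1 < z \<longrightarrow> z < y1 \<longrightarrow> nat (z mod int m) \<notin> \<beta>"
      then show ?thesis using pos[of x1 y1] xy1 by auto
    next
      assume "\<forall>z. y1 < z \<longrightarrow> z < x1 + int m \<longrightarrow> nat (z mod int m) \<notin> \<beta>"
      then have "orient (pt m y1) (pt m (x1 + int m)) p > 0 \<and>
        (\<forall>w\<in>\<beta>. orient (pt m y1) (pt m (x1 + int m)) (pt m (int w)) \<ge> 0)"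
        using pos[of y1 "x1 + int m"] xy1 by auto
      then show ?thesis using xy1(4) edge_swap by metis
    qed
    then obtain u v where uv: "edge m x y = edge m u v" "orient (pt m u) (pt m v) p > 0"
      "\<forall>w\<in>\<beta>. orient (pt m u) (pt m v) (pt m (int w)) \<ge> 0" by blast
    note cong = orient_product_cong[OF uv(1) m0]
    have "orient (pt m x) (pt m y) p * orient (pt m x) (pt m y) p > 0" using uv cong by simp
    then have "orient (pt m x) (pt m y) p \<noteq> 0" by auto
    then show ?thesis using uv cong by simp
  qed
  have p: "p \<in> interior (polygon m) - (\<Union>D\<in>\<Theta>. chord m D)"
    using orient_nonzero_iff[OF m \<Theta> pint] side pint by blast
  have "corners m (same_side m \<Theta> p) = \<beta>"
    unfolding corners_same_side[OF m \<Theta> p]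
  proof (intro equalityI subsetI)
    fix v assume "v \<in> \<beta>"
    then show "v \<in> {v. v < m \<and> (\<forall>x y. edge m x y \<in> \<Theta> \<longrightarrow>
      orient (pt m x) (pt m y) p * orient (pt m x) (pt m y) (pt m (int v)) \<ge> 0)}"
      using side r by auto
  next
    fix v assume v: "v \<in> {v. v < m \<and> (\<forall>x y. edge m x y \<in> \<Theta> \<longrightarrow>
      orient (pt m x) (pt m y) p * orient (pt m x) (pt m y) (pt m (int v)) \<ge> 0)}"
    show "v \<in> \<beta>"
    proof (rule ccontr)
      assume "v \<notin> \<beta>"
      then have "nat (int v mod int m) \<notin> \<beta>" using v by simp
      then obtain x y where xy: "x < int v" "int v < y" "y < x + int m" "edge m x y \<in> \<Theta>"
         "\<forall>w. x < w \<longrightarrow> w < y \<longrightarrow> nat (w mod int m) \<notin> \<beta>" using r by blast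
      then have "orient (pt m x) (pt m y) p > 0" using pos[of x y] by auto
      moreover have "orient (pt m x) (pt m y) (pt m (int v)) < 0" using xy orient_pt_neg by blast
      ultimately have "orient (pt m x) (pt m y) p * orient (pt m x) (pt m y) (pt m (int v)) < 0"
        by (rule mult_pos_neg)
      then show False using v xy by fastforce
    qed
  qed
  moreover have "same_side m \<Theta> p \<in> regions m \<Theta>"
    unfolding regions_def components_def connected_component_same_side[OF m \<Theta> p, symmetric]
    using p by blast
  ultimately show "\<beta> \<in> faces m \<Theta>" unfolding faces_def by blast
qed

section \<open>The center and the central polygon\<close>

lemma zero_in_interior_polygon:
  assumes "m \<ge> 3" shows "0 \<in> interior (polygon m)"
proof -
  have S: "vertex m ` {..<m} = {z. z ^ m = 1}"
    using Complex.bij_betw_roots_unity[of m] assms by (simp add: bij_betw_def vertex_def[abs_def])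
  have card: "card (vertex m ` {..<m}) = m"
    using S card_roots_unity_eq[of m] assms by simp
  \<comment> \<open>The vertices are the roots of unity, which sum to zero; equal positive weights
    on all of them put the center in the relative interior.\<close>
  have "0 \<in> rel_interior (convex hull (vertex m ` {..<m}))"
  proof (rule subsetD[OF explicit_subset_rel_interior_convex_hull], simp,
      intro CollectI exI[of _ "\<lambda>_. 1 / real m"] conjI ballI)
    show "(\<Sum>v\<in>vertex m ` {..<m}. (1 / real m) *\<^sub>R v) = 0"
      using sum_roots_unity[of m] assms by (simp add: S flip: scaleR_sum_right)
  qed (use assms card in auto)
  moreover have "interior (polygon m) \<noteq> {}"
    using triangle_center_interior[of 0 1 2 m] assms by auto
  ultimately show ?thesis by (simp add: polygon_def rel_interior_nonempty_interior)
qed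

lemma orient_pt_zero: "orient (pt m x) (pt m y) 0 = sin (2 * pi * of_int (y - x) / of_nat m)"
  by (simp add: orient_def pt_def sin_diff diff_divide_distrib right_diff_distrib algebra_simps)

text \<open>The central angle stays below pi, so its sine is positive: the center is on the side
  away from the arc.\<close>

lemma orient_zero_short:
  assumes "x < y" "2 * (y - x) < int m" shows "orient (pt m x) (pt m y) 0 > 0"
proof -
  have m: "real m > 0" using assms by (cases m) auto
  have "2 * real_of_int (y - x) < real m" using assms by linarith
  then have "pi * (2 * real_of_int (y - x)) < pi * real m"  by simp
  then have "2 * pi * of_int (y - x) / of_nat m < pi" "2 * pi * of_int (y - x) / of_nat m > 0"
    using m assms by (simp_all add: field_simps)
  then show ?thesis unfolding orient_pt_zero by (intro sin_gt_zero)
qed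

lemma zero_in_chord_iff:
  assumes "m \<ge> 3" "x < y" "y < x + int m"
  shows "0 \<in> chord m (edge m x y) \<longleftrightarrow> 2 * (y - x) = int m"
proof
  assume "0 \<in> chord m (edge m x y)"
  then have z: "orient (pt m x) (pt m y) 0 = 0"
    using assms by (simp add: chord_edge orient_eq_0_on_segment)
  have "\<not> 2 * (y - x) < int m" using orient_zero_short[of x y m] z assms by auto
  moreover have "\<not> 2 * (x + int m - y) < int m"
  proof
    assume "2 * (x + int m - y) < int m"
    then have "orient (pt m y) (pt m (x + 1 * int m)) 0 > 0" using orient_zero_short[of y "x + int m" m] assms by auto
    then have "orient (pt m y) (pt m x) 0 > 0" using pt_shift[of m x 1] assms by simp
    then show False using z by (simp add: orient_def algebra_simps)
  qed
  ultimately show "2 * (y - x) = int m" by presburger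
next
  assume *: "2 * (y - x) = int m"
  then have "real m = 2 * real_of_int (y - x)" by linarith
  then have "2 * pi * of_int (y - x) / of_nat m = pi" using assms
    by (simp add: divide_eq_eq)
  then have "orient (pt m x) (pt m y) 0 = 0" unfolding orient_pt_zero by simp
  then show "0 \<in> chord m (edge m x y)"
    using assms pt_neq[of x y m] by (simp add: chord_edge on_line_in_segment norm_pt)
qed

text \<open>Two distinct diameters would cross at the center, so the \<open>THE\<close> in
  \<open>central_polygon\<close> is well defined. The lemma is used to exclude diameters when the
  central polygon has more than two vertices.\<close>

lemma card_central_diameter:
  assumes m: "m \<ge> 3" and d: "is_dissection m \<Theta>" and D: "D \<in> \<Theta>" "0 \<in> chord m D"
  shows "card (central_polygon m \<Theta>) = 2"
proof -
  have sub: "\<Theta> \<subseteq> diagonals m" using d by (simp add: is_dissection_def)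
  have mid: "0 \<in> rel_interior (chord m E)" if E: "E \<in> \<Theta>" "0 \<in> chord m E" for E
  proof -
    obtain x y where xy: "0 \<le> x" "x < y" "y < 0 + int m" "E = edge m x y"
      using diagonal_lift E sub by (metis subsetD)
    have "0 \<in> closed_segment (pt m x) (pt m y)" using E xy m by (simp add: chord_edge)
    moreover have "pt m x \<noteq> 0" "pt m y \<noteq> 0" by (auto simp: pt_def)
    ultimately show ?thesis using xy m pt_neq[of x y m]
      by (auto simp: chord_edge rel_interior_closed_segment open_segment_def)
  qed
  have "(THE E. E \<in> \<Theta> \<and> 0 \<in> chord m E) = D"
  proof (rule the_equality)
    show "E = D" if "E \<in> \<Theta> \<and> 0 \<in> chord m E" for E
    proof (rule ccontr)
      assume "E \<noteq> D"
      then have "\<not> crossing m E D" using d that D unfolding is_dissection_def by blast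
      then show False using mid[of E] mid[of D] that D by (auto simp: crossing_def)
    qed
  qed (use D in blast)
  then have "central_polygon m \<Theta> = D" using D by (auto simp: central_polygon_def)
  then show ?thesis using D sub by (auto simp: diagonals_def)
qed

text \<open>A diagonal that is no diameter has exactly one arc shorter than half a turn, and the
  center lies on the other side. Corners of the central region are thus the labels strictly under no
  short arc.\<close>

lemma central_polygon_eq:
  assumes m: "m \<ge> 3" and \<Theta>: "\<Theta> \<subseteq> diagonals m" and nd: "\<forall>D\<in>\<Theta>. 0 \<notin> chord m D"
  shows "central_polygon m \<Theta> = {v. v < m \<and>
    (\<forall>x y. x < int v \<longrightarrow> int v < y \<longrightarrow> 2 * (y - x) < int m \<longrightarrow> edge m x y \<notin> \<Theta>)}"
proof -
  have m0: "m > 0" using m by simp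
  let ?S = "interior (polygon m) - (\<Union>D\<in>\<Theta>. chord m D)"
  have p: "0 \<in> ?S" using zero_in_interior_polygon[OF m] nd by auto
  have "(THE F. F \<in> regions m \<Theta> \<and> 0 \<in> F) = connected_component_set ?S 0"
  proof (rule the_equality)
    show "connected_component_set ?S 0 \<in> regions m \<Theta> \<and> 0 \<in> connected_component_set ?S 0"
      using p by (simp add: regions_def componentsI)
    fix F assume F: "F \<in> regions m \<Theta> \<and> 0 \<in> F"
    then obtain q where "F = connected_component_set ?S q" by (auto simp: regions_def components_def)
    then show "F = connected_component_set ?S 0" using F connected_component_eq by metis
  qed
  then have c: "central_polygon m \<Theta> = {v. v < m \<and> (\<forall>x y. edge m x y \<in> \<Theta> \<longrightarrow>
     orient (pt m x) (pt m y) 0 * orient (pt m x) (pt m y) (pt m (int v)) \<ge> 0)}"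
    using nd by (auto simp: central_polygon_def connected_component_same_side[OF m \<Theta> p]
        corners_same_side[OF m \<Theta> p])
  show ?thesis unfolding c
  proof (intro Collect_cong conj_cong refl iffI allI impI notI)
    fix v x y
    assume a: "\<forall>x y. edge m x y \<in> \<Theta> \<longrightarrow>
        orient (pt m x) (pt m y) 0 * orient (pt m x) (pt m y) (pt m (int v)) \<ge> 0"
      "x < int v" "int v < y" "2 * (y - x) < int m" "edge m x y \<in> \<Theta>"
    have "orient (pt m x) (pt m y) 0 > 0" using orient_zero_short a by simp
    moreover have "orient (pt m x) (pt m y) (pt m (int v)) < 0" using orient_pt_neg a by simp
    ultimately show False using a by (meson mult_pos_neg not_less)
  next
    fix v x y
    assume a: "\<forall>x y. x < int v \<longrightarrow> int v < y \<longrightarrow> 2 * (y - x) < int m \<longrightarrow> edge m x y \<notin> \<Theta>"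
      "edge m x y \<in> \<Theta>" "v < m"
    obtain x1 y1 where xy1: "int v \<le> x1" "x1 < y1" "y1 < int v + int m" "edge m x y = edge m x1 y1"
      using diagonal_lift a(2) \<Theta> by (metis subsetD)
    \<comment> \<open>The lift was started at \<open>v\<close>, so unless \<open>v\<close> is its
      first end, \<open>v\<close> lies strictly under the complementary arc from \<open>x2\<close>
      to \<open>x1\<close>.\<close>
    define x2 where "x2 = y1 - int m"
    have e2: "edge m x y = edge m x2 x1"
      using xy1(4) edge_swap[of m x1 x2] edge_commute by (simp add: x2_def)
    have "0 \<notin> chord m (edge m x1 y1)" using nd a xy1 by metis
    then have ne: "2 * (y1 - x1) \<noteq> int m" using zero_in_chord_iff[OF m, of x1 y1] xy1 a by auto
    have "orient (pt m x1) (pt m y1) 0 * orient (pt m x1) (pt m y1) (pt m (int v)) \<ge> 0"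
    proof (cases "x1 = int v")
      case True then show ?thesis by (simp add: orient_same)
    next
      case False
      then have v: "int v < x1" "x2 < int v" using xy1 by (auto simp: x2_def)
      have "\<not> 2 * (x1 - x2) < int m" using a(1) v e2 a(2) by metis
      then have "2 * (y1 - x1) < int m" using ne by (auto simp: x2_def)
      then have "orient (pt m x1) (pt m y1) 0 > 0" using orient_zero_short xy1 by simp
      moreover have "orient (pt m x1) (pt m y1) (pt m (int v)) > 0"
        using orient_pt_pos[of x1 y1 "int v + 1 * int m" m] xy1 v pt_shift[OF m0, of "int v" 1] by simp
      ultimately show ?thesis by simp
    qed
    then show "orient (pt m x) (pt m y) 0 * orient (pt m x) (pt m y) (pt m (int v)) \<ge> 0"
      using orient_product_cong[OF xy1(4) m0] by simp
  qed
qed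

section \<open>Periodic arc systems\<close>

text \<open>The upper bound admits length \<open>j - 1\<close>, although such an arc is a side
  modulo \<open>j\<close>. The noncrossing clause leaves nested arcs and common endpoints
  possible.\<close>

definition arc_system :: "nat \<Rightarrow> (int \<times> int) set \<Rightarrow> bool" where
  "arc_system j R \<longleftrightarrow>
     (\<forall>x y. (x, y) \<in> R \<longrightarrow> x + 2 \<le> y \<and> y < x + int j) \<and>
     (\<forall>x y k. (x, y) \<in> R \<longrightarrow> (x + k * int j, y + k * int j) \<in> R) \<and>
     (\<forall>x x' y y'. (x, y) \<in> R \<longrightarrow> (x', y') \<in> R \<longrightarrow> x < x' \<longrightarrow> x' < y \<longrightarrow> y' \<le> y)"

definition uncovered :: "(int \<times> int) set \<Rightarrow> int \<Rightarrow> bool" where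
  "uncovered R z \<longleftrightarrow> (\<forall>x y. (x, y) \<in> R \<longrightarrow> x < z \<longrightarrow> y \<le> z)"

definition uncovered_labels :: "nat \<Rightarrow> (int \<times> int) set \<Rightarrow> nat set" where
  "uncovered_labels j R = {v. v < j \<and> uncovered R (int v)}"

text \<open>For a periodic \<open>R\<close> this picks one representative of each arc modulo
  translation by the period, which makes arcs countable.\<close>

definition base_arcs :: "nat \<Rightarrow> (int \<times> int) set \<Rightarrow> (int \<times> int) set" where
  "base_arcs j R = {(x, y) \<in> R. 0 \<le> x \<and> x < int j}"

definition edges_of :: "nat \<Rightarrow> (int \<times> int) set \<Rightarrow> nat set set" where
  "edges_of m R = (\<lambda>(x, y). edge m x y) ` R"

lemma arc_systemD:
  assumes "arc_system j R"
  shows "(x, y) \<in> R \<Longrightarrow> x + 2 \<le> y" "(x, y) \<in> R \<Longrightarrow> y < x + int j"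
    "(x, y) \<in> R \<Longrightarrow> (x + k * int j, y + k * int j) \<in> R"
    "(x, y) \<in> R \<Longrightarrow> (x', y') \<in> R \<Longrightarrow> x < x' \<Longrightarrow> x' < y \<Longrightarrow> y' \<le> y"
  using assms unfolding arc_system_def by blast+

lemma edges_ofI: "(x, y) \<in> R \<Longrightarrow> edge m x y \<in> edges_of m R"
  unfolding edges_of_def by force

lemma edges_ofE:
  assumes "D \<in> edges_of m R" obtains x y where "(x, y) \<in> R" "D = edge m x y"
  using assms unfolding edges_of_def by force

lemma mod_eq_obtain:
  fixes a b m :: int assumes "a mod m = b mod m" obtains k where "a = b + k * m"
proof -
  obtain k where "a - b = m * k" using assms unfolding mod_eq_dvd_iff by (rule dvdE)
  then show ?thesis using that[of k] by (simp add: algebra_simps)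
qed

text \<open>An edge forgets which of its two arcs it came from, hence the alternative in the
  conclusion.\<close>

lemma edge_in_edges_of:
  assumes per: "\<And>x y k. (x, y) \<in> R \<Longrightarrow> (x + k * int m, y + k * int m) \<in> R"
    and len: "\<And>x y. (x, y) \<in> R \<Longrightarrow> x < y \<and> y < x + int m"
    and "x < y" "y < x + int m" "edge m x y \<in> edges_of m R"
  shows "(x, y) \<in> R \<or> (y, x + int m) \<in> R"
proof -
  have m: "m > 0" using assms(3,4) by (cases m) auto
  obtain u v where uv: "(u, v) \<in> R" "edge m x y = edge m u v" using assms(5) by (rule edges_ofE)
  consider "x mod int m = u mod int m" "y mod int m = v mod int m"
    | "x mod int m = v mod int m" "y mod int m = u mod int m"
    using uv m by (auto simp: edge_eq_iff)
  then show ?thesis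
  proof cases
    case 1
    then obtain k where k: "x = u + k * int m" using mod_eq_obtain by metis
    then have r: "(x, v + k * int m) \<in> R" using per uv by blast
    have "(v + k * int m) mod int m = y mod int m" using 1 by simp
    then have "v + k * int m = y"
      using len[OF r] assms(3,4) mod_eq_imp_eq[of "v + k * int m" "int m" y] by auto
    then show ?thesis using r by simp
  next
    case 2
    then obtain k where k: "y = u + k * int m" using mod_eq_obtain by metis
    then have r: "(y, v + k * int m) \<in> R" using per uv by blast
    have "(v + k * int m) mod int m = (x + int m) mod int m" using 2 by simp
    then have "v + k * int m = x + int m"
      using len[OF r] assms(3,4) mod_eq_imp_eq[of "v + k * int m" "int m" "x + int m"] by auto
    then show ?thesis using r by simp
  qed
qed

text \<open>A general multiple \<open>m = d * j\<close> is taken because the same arcs are read both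
  modulo \<open>n\<close> and modulo \<open>j\<close>, the latter with \<open>d = 1\<close>.\<close>

lemma edge_in_edges_of_arc_system:
  assumes R: "arc_system j R" and "0 < d" "m = d * j"
    and "x < y" "y < x + int m" "edge m x y \<in> edges_of m R"
  shows "(x, y) \<in> R \<or> (y, x + int m) \<in> R"
proof (rule edge_in_edges_of[OF _ _ assms(4-6)])
  show "(x + k * int m, y + k * int m) \<in> R" if "(x, y) \<in> R" for x y k
    using arc_systemD(3)[OF R that, of "k * int d"] assms(3) by (simp add: mult.assoc)
  have "1 * j \<le> d * j" using assms(2) by (intro mult_le_mono1) simp
  then have "int j \<le> int m" using assms(3) by linarith
  then show "x < y \<and> y < x + int m" if "(x, y) \<in> R" for x y
    using arc_systemD(1,2)[OF R that] by linarith
qed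

text \<open>Each of two interlacing chords comes from one of its two arcs. In each of the four
  combinations, up to a shift by \<open>m\<close>, the two arcs interlace on the integers.\<close>

lemma edges_of_noncrossing:
  assumes R: "arc_system j R" and d: "0 < d" "m = d * j"
    and xy: "x < x'" "x' < y" "y < y'" "y' < x + int m"
    and "edge m x y \<in> edges_of m R" "edge m x' y' \<in> edges_of m R"
  shows False
proof -
  have s: "(a - int m, b - int m) \<in> R" if "(a, b) \<in> R" for a b
    using arc_systemD(3)[OF R that, of "- int d"] d by simp
  have "(x, y) \<in> R \<or> (y, x + int m) \<in> R"
    using edge_in_edges_of_arc_system[OF R d, of x y] assms by simp
  moreover have "(x', y') \<in> R \<or> (y', x' + int m) \<in> R"
    using edge_in_edges_of_arc_system[OF R d, of x' y'] assms by simp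
  moreover have "(y', x' + int m) \<in> R \<Longrightarrow> (y' - int m, x') \<in> R" using s[of y' "x' + int m"] by simp
  ultimately show False
    using arc_systemD(4)[OF R, of x y x' y'] arc_systemD(4)[OF R, of x' y' y "x + int m"]
      arc_systemD(4)[OF R, of "y' - int m" x' x y] arc_systemD(4)[OF R, of y "x + int m" y' "x' + int m"]
      xy by linarith
qed

section \<open>Uncovered points and counting modulo translation\<close>

lemma uncovered_shift:
  assumes "arc_system j R" shows "uncovered R (z + k * int j) \<longleftrightarrow> uncovered R z"
proof -
  have *: "uncovered R (z + k * int j)" if "uncovered R z" for z k
    unfolding uncovered_def
  proof (intro allI impI)
    fix x y assume "(x, y) \<in> R" "x < z + k * int j"
    then show "y \<le> z + k * int j"
      using arc_systemD(3)[OF assms, of x y "- k"] that unfolding uncovered_def by fastforce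
  qed
  show ?thesis using *[of z k] *[of "z + k * int j" "- k"] by auto
qed

lemma uncovered_mod:
  assumes "arc_system j R" "j > 0"
  shows "nat (z mod int j) \<in> uncovered_labels j R \<longleftrightarrow> uncovered R z"
proof -
  have "z = z mod int j + (z div int j) * int j" by simp
  then have "uncovered R z \<longleftrightarrow> uncovered R (z mod int j)" using uncovered_shift[OF assms(1)] by metis
  then show ?thesis using assms(2) by (simp add: uncovered_labels_def nat_less_iff)
qed

text \<open>A window of length \<open>d * j\<close> consists of \<open>d\<close> translates of a
  window of length \<open>j\<close>. Only periodicity is assumed, so that the lemma counts uncovered
  points as well as arcs.\<close>

lemma card_periodic:
  assumes per: "\<And>x y k. (x, y) \<in> R \<Longrightarrow> (x + k * int j, y + k * int j) \<in> R" and "j > 0"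
  shows "card (base_arcs (d * j) R) = d * card (base_arcs j R)"
proof -
  have "bij_betw (\<lambda>(i, (x, y)). (x + int i * int j, y + int i * int j))
      ({..<d} \<times> base_arcs j R) (base_arcs (d * j) R)"
  proof (rule bij_betw_byWitness[where f' = "\<lambda>(x, y). (nat (x div int j), (x mod int j, y - (x div int j) * int j))"])
    show "\<forall>a\<in>{..<d} \<times> base_arcs j R.
       (\<lambda>(x, y). (nat (x div int j), (x mod int j, y - (x div int j) * int j)))
         ((\<lambda>(i, (x, y)). (x + int i * int j, y + int i * int j)) a) = a"
      using \<open>j > 0\<close> by (auto simp: base_arcs_def)
    show "\<forall>a\<in>base_arcs (d * j) R.
       (\<lambda>(i, (x, y)). (x + int i * int j, y + int i * int j))
         ((\<lambda>(x, y). (nat (x div int j), (x mod int j, y - (x div int j) * int j))) a) = a"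
      using \<open>j > 0\<close> by (auto simp: base_arcs_def pos_imp_zdiv_nonneg_iff)
    show "(\<lambda>(i, (x, y)). (x + int i * int j, y + int i * int j)) ` ({..<d} \<times> base_arcs j R) \<subseteq> base_arcs (d * j) R"
    proof
      fix b assume "b \<in> (\<lambda>(i, (x, y)). (x + int i * int j, y + int i * int j)) ` ({..<d} \<times> base_arcs j R)"
      then obtain i x y where a: "i < d" "(x, y) \<in> base_arcs j R"
        and b: "b = (x + int i * int j, y + int i * int j)" by auto
      then have "int i + 1 \<le> int d" by auto
      then have "(int i + 1) * int j \<le> int d * int j" by (intro mult_right_mono) auto
      then show "b \<in> base_arcs (d * j) R"
        using a b per by (auto simp: base_arcs_def algebra_simps)
    qed
    show "(\<lambda>(x, y). (nat (x div int j), (x mod int j, y - (x div int j) * int j))) ` base_arcs (d * j) R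
        \<subseteq> {..<d} \<times> base_arcs j R"
    proof
      fix b assume "b \<in> (\<lambda>(x, y). (nat (x div int j), (x mod int j, y - (x div int j) * int j))) ` base_arcs (d * j) R"
      then obtain x y where a: "(x, y) \<in> base_arcs (d * j) R"
        and b: "b = (nat (x div int j), (x mod int j, y - (x div int j) * int j))" by auto
      then have x: "(x, y) \<in> R" "0 \<le> x" "x < int d * int j" by (auto simp: base_arcs_def)
      have "x div int j * int j \<le> x"
        using minus_div_mult_eq_mod[of x "int j"] pos_mod_sign[of "int j" x] \<open>j > 0\<close> by linarith
      then have "x div int j * int j < int d * int j" using x by linarith
      then have "x div int j < int d" using \<open>j > 0\<close> by simp
      moreover have "x div int j \<ge> 0" using x \<open>j > 0\<close> by (simp add: pos_imp_zdiv_nonneg_iff)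
      moreover have "x mod int j = x + (- (x div int j)) * int j"
        using minus_div_mult_eq_mod[of x "int j"] by simp
      then have "(x mod int j, y - (x div int j) * int j) \<in> R" using per[OF x(1), of "- (x div int j)"] by simp
      ultimately show "b \<in> {..<d} \<times> base_arcs j R"
        unfolding b using \<open>j > 0\<close> by (auto simp: base_arcs_def nat_less_iff)
    qed
  qed
  then have "card ({..<d} \<times> base_arcs j R) = card (base_arcs (d * j) R)"
    by (rule bij_betw_same_card)
  then show ?thesis by (simp add: card_cartesian_product)
qed

lemma card_uncovered_labels_mult:
  assumes R: "arc_system j R" and "j > 0"
  shows "card (uncovered_labels (d * j) R) = d * card (uncovered_labels j R)"
proof -
  \<comment> \<open>Uncovered points are disguised as degenerate arcs so that
    \<open>card_periodic\<close> applies.\<close>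
  let ?U = "{(z, z) | z. uncovered R z}"
  have c: "card (uncovered_labels m R) = card (base_arcs m ?U)" for m
  proof -
    have "base_arcs m ?U = (\<lambda>v. (int v, int v)) ` uncovered_labels m R"
      by (auto simp: base_arcs_def uncovered_labels_def image_iff) (metis int_nat_eq nat_less_iff)
    then show ?thesis by (simp add: card_image inj_on_def)
  qed
  have "card (base_arcs (d * j) ?U) = d * card (base_arcs j ?U)"
    using uncovered_shift[OF R] by (intro card_periodic \<open>j > 0\<close>) auto
  then show ?thesis by (simp add: c)
qed

text \<open>By the noncrossing condition, an arc of maximal length between \<open>p\<close> and \<open>q\<close> must end in \<open>p\<close> and \<open>q\<close>.\<close>

lemma closing_arc:
  assumes R: "arc_system j R" and pq: "p + 2 \<le> q" "uncovered R p" "uncovered R q"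
    and cov: "\<And>z. p < z \<Longrightarrow> z < q \<Longrightarrow> \<not> uncovered R z"
  shows "(p, q) \<in> R"
proof -
  let ?P = "\<lambda>(x, y). (x, y) \<in> R \<and> p \<le> x \<and> y \<le> q"
  \<comment> \<open>An arc over a point between \<open>p\<close> and \<open>q\<close> cannot extend
    beyond them, since it would cover \<open>p\<close> or \<open>q\<close>.\<close>
  have inner: "?P (x, y)" if "(x, y) \<in> R" "x < z" "z < y" "p < z" "z < q" for x y z
  proof -
    have "p \<le> x" using pq(2) that unfolding uncovered_def by force
    moreover have "y \<le> q" using pq(3) that unfolding uncovered_def by force
    ultimately show ?thesis using that by simp
  qed
  have cover: "\<exists>x y. ?P (x, y) \<and> x < z \<and> z < y" if z: "p < z" "z < q" for z
  proof -
    obtain x y where "(x, y) \<in> R" "x < z" "z < y"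
      using cov[OF z] unfolding uncovered_def by force
    then show ?thesis using inner[of x y z] z by blast
  qed
  obtain a0 where a0: "?P a0" using cover[of "p + 1"] pq(1) by force
  obtain a where a: "?P a" and mx: "\<forall>b. ?P b \<longrightarrow> nat (snd b - fst b) \<le> nat (snd a - fst a)"
    using ex_has_greatest_nat[of ?P a0 "\<lambda>b. nat (snd b - fst b)" "nat (q - p)"] a0
    by force
  obtain x y where axy: "a = (x, y)" by fastforce
  have xy: "(x, y) \<in> R" "p \<le> x" "y \<le> q" using a axy by auto
  have lt: "x + 2 \<le> y" using arc_systemD(1)[OF R xy(1)] .
  \<comment> \<open>Otherwise the end \<open>x\<close> is itself covered, and noncrossing forces the
    covering arc to reach to \<open>y\<close> or beyond, which makes it longer than the longest arc.
    The end \<open>y\<close> is treated in the same way.\<close>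
  have "x = p"
  proof (rule ccontr)
    assume "x \<noteq> p"
    then obtain u v where uv: "?P (u, v)" "u < x" "x < v" using cover[of x] xy lt by force
    then have "y \<le> v" using arc_systemD(4)[OF R, of u v x y] xy by auto
    moreover have "nat (v - u) \<le> nat (y - x)" using mx uv(1) axy by force
    ultimately show False using uv lt by simp
  qed
  moreover have "y = q"
  proof (rule ccontr)
    assume "y \<noteq> q"
    then obtain u v where uv: "?P (u, v)" "u < y" "y < v" using cover[of y] xy lt by force
    have "u \<le> x"
    proof (rule ccontr)
      assume "\<not> u \<le> x"
      then have "v \<le> y" using arc_systemD(4)[OF R, of x y u v] xy uv by auto
      then show False using uv by simp
    qed
    moreover have "nat (v - u) \<le> nat (y - x)" using mx uv(1) axy by force
    ultimately show False using uv lt by simp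
  qed
  ultimately show ?thesis using xy by simp
qed

section \<open>Invariant dissections\<close>

text \<open>The length bound does the orienting: for \<open>j \<le> n / 2\<close> the complement of
  an arc shorter than \<open>j\<close> is longer than \<open>j\<close>, so at most one direction of
  each diagonal qualifies.\<close>

definition arcs_of :: "nat \<Rightarrow> nat \<Rightarrow> nat set set \<Rightarrow> (int \<times> int) set" where
  "arcs_of n j \<Theta> = {(x, y). x + 2 \<le> y \<and> y < x + int j \<and> edge n x y \<in> \<Theta>}"

lemma rotation_funpow:
  assumes "v < n" shows "(rotation n ^^ j) v = (v + j) mod n"
proof (induction j)
  case 0 then show ?case using assms by simp
next
  case (Suc j) then show ?case by (simp add: rotation_def mod_Suc_eq)
qed

lemma rotation_edge:
  assumes "n > 0"
  shows "(rotation n ^^ j) ` edge n x y = edge n (x + int j) (y + int j)"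
proof -
  have "(rotation n ^^ j) (nat (z mod int n)) = nat ((z + int j) mod int n)" for z
  proof -
    have "nat (z mod int n) < n" using assms by (simp add: nat_less_iff)
    then have "int ((rotation n ^^ j) (nat (z mod int n))) = (z mod int n + int j) mod int n"
      using assms by (simp add: rotation_funpow zmod_int)
    also have "\<dots> = (z + int j) mod int n" by (simp add: mod_add_left_eq)
    finally show ?thesis by (metis nat_int)
  qed
  then show ?thesis by (simp add: edge_def)
qed

text \<open>Invariance is an equality of sets, so diagonals can also be rotated backwards; this
  covers negative \<open>k\<close>.\<close>

lemma edge_invariant:
  assumes "n > 0" "\<Theta> \<subseteq> diagonals n" and inv: "invariant_under (rotation n ^^ j) \<Theta>"
    and e: "edge n x y \<in> \<Theta>"
  shows "edge n (x + k * int j) (y + k * int j) \<in> \<Theta>"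
proof -
  have up: "edge n (x + int j) (y + int j) \<in> \<Theta>" if "edge n x y \<in> \<Theta>" for x y
    using inv that rotation_edge[OF assms(1), of j x y] unfolding invariant_under_def by blast
  have down: "edge n (x - int j) (y - int j) \<in> \<Theta>" if "edge n x y \<in> \<Theta>" for x y
  proof -
    have "edge n x y \<in> (\<lambda>D. (rotation n ^^ j) ` D) ` \<Theta>"
      using inv that by (simp add: invariant_under_def)
    then obtain D where D: "D \<in> \<Theta>" "(rotation n ^^ j) ` D = edge n x y" by force
    obtain u v where uv: "D = edge n u v" using diagonal_lift[of D n 0] D(1) assms(2) by blast
    then have "edge n x y = edge n (u + int j) (v + int j)" using D rotation_edge[OF assms(1)] by simp
    then have "edge n (x - int j) (y - int j) = edge n u v"
      unfolding edge_eq_iff[OF assms(1)] by (auto simp: mod_eq_dvd_iff algebra_simps)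
    then show ?thesis using D uv by simp
  qed
  show ?thesis
  proof (induction k rule: int_induct[where k = 0])
    case base then show ?case using e by simp
  next
    case (step1 i) then show ?case using up[OF step1(2)] by (simp add: algebra_simps)
  next
    case (step2 i) then show ?case using down[OF step2(2)] by (simp add: algebra_simps)
  qed
qed

lemma arcs_of_invariant_dissection:
  assumes n: "n = d * j" and d: "2 \<le> d" and j: "3 \<le> j" and r: "2 \<le> r"
    and \<Theta>: "\<Theta> \<in> invariant_dissections (r * d) n k (rotation n ^^ j)"
  shows "arc_system j (arcs_of n j \<Theta>)"
    and "edges_of n (arcs_of n j \<Theta>) = \<Theta>"
    and "card (uncovered_labels j (arcs_of n j \<Theta>)) = r"
proof -
  have nj: "int n \<ge> 2 * int j"
  proof -
    have "2 * j \<le> d * j" using d by simp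
    then show ?thesis using n by linarith
  qed
  then have n3: "n \<ge> 3" "n > 0" using j by auto
  have dis: "is_dissection n \<Theta>" and inv: "invariant_under (rotation n ^^ j) \<Theta>"
    and cc: "card (central_polygon n \<Theta>) = r * d"
    using \<Theta> by (auto simp: invariant_dissections_def dissections_def)
  have sub: "\<Theta> \<subseteq> diagonals n"
    and cross: "\<And>x x' y y'. x < x' \<Longrightarrow> x' < y \<Longrightarrow> y < y' \<Longrightarrow> y' < x + int n \<Longrightarrow>
       edge n x y \<in> \<Theta> \<Longrightarrow> edge n x' y' \<in> \<Theta> \<Longrightarrow> False"
    using dis unfolding is_dissection_iff[OF n3(1)] by blast+
  \<comment> \<open>The central polygon has at least four vertices, which excludes a
    diameter.\<close>
  have "r * d \<ge> 2 * 2" using r d by (intro mult_mono) auto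
  then have nd: "\<forall>D\<in>\<Theta>. 0 \<notin> chord n D" using card_central_diameter[OF n3(1) dis] cc by fastforce
  note central = central_polygon_eq[OF n3(1) sub nd]
  note shift = edge_invariant[OF n3(2) sub inv]
  have short: "y < x + int j" if xy: "x < y" "2 * (y - x) < int n" "edge n x y \<in> \<Theta>" for x y
  proof (rule ccontr)
    assume "\<not> ?thesis"
    then consider "y = x + int j" | "x + int j < y" by linarith
    then show False
    proof cases
      case 1
      \<comment> \<open>The translates of an arc of length exactly \<open>j\<close> lie end to end,
        so only integers congruent to \<open>x\<close> modulo \<open>j\<close> stay uncovered. Among
        \<open>n\<close> labels these are \<open>d\<close>, fewer than \<open>r * d\<close>.\<close>
      have "central_polygon n \<Theta> \<subseteq> (\<lambda>i. nat (x mod int j) + i * j) ` {..<d}"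
      proof
        fix v assume v: "v \<in> central_polygon n \<Theta>"
        define q where "q = (int v - x) div int j"
        have "int v - x = q * int j + (int v - x) mod int j" by (simp add: q_def)
        moreover have "0 \<le> (int v - x) mod int j" "(int v - x) mod int j < int j" using j by auto
        moreover have "\<not> (x + q * int j < int v \<and> int v < y + q * int j)"
          using v shift[OF xy(3), of q] xy(2) unfolding central by auto
        ultimately have "(int v - x) mod int j = 0" using 1 by linarith
        then have "int v mod int j = x mod int j" by (simp add: mod_eq_dvd_iff dvd_eq_mod_eq_0)
        then have "nat (x mod int j) = v mod j" by (metis nat_int of_nat_mod)
        then have "v = nat (x mod int j) + (v div j) * j" by simp
        moreover have "v div j < d" using v n unfolding central by (simp add: less_mult_imp_div_less)
        ultimately show "v \<in> (\<lambda>i. nat (x mod int j) + i * j) ` {..<d}" by blast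
      qed
      then have "card (central_polygon n \<Theta>) \<le> card {..<d}" by (rule surj_card_le[rotated]) simp
      then have "r * d \<le> d" using cc by simp
      then show False using r d by simp
    next
      case 2
      \<comment> \<open>The arc interlaces with its translate by \<open>j\<close>. From
        \<open>j < y - x\<close> and \<open>2 * (y - x) < n\<close> the translate still ends within
        one turn of \<open>x\<close>.\<close>
      show False
        using cross[of x "x + int j" y "y + int j"] shift[OF xy(3), of 1] xy 2 nj j by auto
    qed
  qed
  show sys: "arc_system j (arcs_of n j \<Theta>)"
    unfolding arc_system_def
  proof (intro conjI allI impI)
    fix x x' y y' assume a: "(x, y) \<in> arcs_of n j \<Theta>" "(x', y') \<in> arcs_of n j \<Theta>" "x < x'" "x' < y"
    show "y' \<le> y"
    proof (rule ccontr)
      assume "\<not> y' \<le> y"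
      then show False using cross[of x x' y y'] a nj by (auto simp: arcs_of_def)
    qed
  qed (use shift in \<open>auto simp: arcs_of_def\<close>)
  show "edges_of n (arcs_of n j \<Theta>) = \<Theta>"
  proof (intro equalityI subsetI)
    fix D assume D: "D \<in> \<Theta>"
    then obtain x y where xy: "0 \<le> x" "x < y" "y < 0 + int n" "D = edge n x y"
      using diagonal_lift sub by (metis subsetD)
    have l: "x + 2 \<le> y \<and> y \<le> x + int n - 2"
      using D sub xy edge_in_diagonals_iff[OF n3(1), of x y] by auto
    have "2 * (y - x) \<noteq> int n" using zero_in_chord_iff[OF n3(1), of x y] nd D xy by auto
    then have "2 * (y - x) < int n \<or> 2 * (x + int n - y) < int n" by presburger
    then consider "2 * (y - x) < int n" | "2 * (x + int n - y) < int n" by blast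
    then show "D \<in> edges_of n (arcs_of n j \<Theta>)"
    proof cases
      case 1
      then have "(x, y) \<in> arcs_of n j \<Theta>" using short[of x y] xy l D by (simp add: arcs_of_def)
      then show ?thesis using edges_ofI xy(4) by metis
    next
      case 2
      have "edge n y (x + int n) = D" using xy(4) edge_swap by simp
      then have "(y, x + int n) \<in> arcs_of n j \<Theta>" using 2 short[of y "x + int n"] xy l D by (simp add: arcs_of_def)
      then show ?thesis using edges_ofI \<open>edge n y (x + int n) = D\<close> by metis
    qed
  qed (auto simp: arcs_of_def edges_of_def)
  have "central_polygon n \<Theta> = uncovered_labels n (arcs_of n j \<Theta>)"
    unfolding central uncovered_labels_def
  proof (intro Collect_cong conj_cong refl iffI)
    fix v assume a: "\<forall>x y. x < int v \<longrightarrow> int v < y \<longrightarrow> 2 * (y - x) < int n \<longrightarrow> edge n x y \<notin> \<Theta>"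
    show "uncovered (arcs_of n j \<Theta>) (int v)" unfolding uncovered_def
    proof (intro allI impI, rule ccontr)
      fix x y assume "(x, y) \<in> arcs_of n j \<Theta>" "x < int v" "\<not> y \<le> int v"
      then show False using a[rule_format, of x y] nj by (auto simp: arcs_of_def)
    qed
  next
    fix v assume a: "uncovered (arcs_of n j \<Theta>) (int v)"
    show "\<forall>x y. x < int v \<longrightarrow> int v < y \<longrightarrow> 2 * (y - x) < int n \<longrightarrow> edge n x y \<notin> \<Theta>"
    proof (intro allI impI notI)
      fix x y assume "x < int v" "int v < y" "2 * (y - x) < int n" "edge n x y \<in> \<Theta>"
      then have "(x, y) \<in> arcs_of n j \<Theta>" using short[of x y] by (simp add: arcs_of_def)
      then show False using a \<open>x < int v\<close> \<open>int v < y\<close> unfolding uncovered_def by force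
    qed
  qed
  then have "d * card (uncovered_labels j (arcs_of n j \<Theta>)) = r * d"
    using card_uncovered_labels_mult[OF sys, of d] j cc n by simp
  then show "card (uncovered_labels j (arcs_of n j \<Theta>)) = r" using d by simp
qed

text \<open>All five claims rest on every arc being shorter than \<open>j \<le> n / 2\<close>:
  modulo \<open>n\<close> no arc becomes a side or a diameter, and none is mistaken for the
  complement of another.\<close>

lemma edges_of_arc_system:
  assumes n: "n = d * j" and d: "2 \<le> d" and j: "3 \<le> j" and R: "arc_system j R"
  shows "is_dissection n (edges_of n R)"
    and "invariant_under (rotation n ^^ j) (edges_of n R)"
    and "card (edges_of n R) = d * card (base_arcs j R)"
    and "card (central_polygon n (edges_of n R)) = d * card (uncovered_labels j R)"
    and "arcs_of n j (edges_of n R) = R"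
proof -
  have nj: "int n \<ge> 2 * int j"
  proof -
    have "2 * j \<le> d * j" using d by simp
    then show ?thesis using n by linarith
  qed
  then have n3: "n \<ge> 3" "n > 0" using j by auto
  have d0: "0 < d" using d by simp
  note mem = edge_in_edges_of_arc_system[OF R d0 n]
  have sub: "edges_of n R \<subseteq> diagonals n"
  proof
    fix D assume "D \<in> edges_of n R"
    then obtain x y where xy: "(x, y) \<in> R" "D = edge n x y" by (rule edges_ofE)
    then show "D \<in> diagonals n"
      using arc_systemD(1,2)[OF R xy(1)] nj j edge_in_diagonals_iff[OF n3(1), of x y] by simp
  qed
  then show dis: "is_dissection n (edges_of n R)"
    unfolding is_dissection_iff[OF n3(1)] using edges_of_noncrossing[OF R d0 n] by blast
  show "invariant_under (rotation n ^^ j) (edges_of n R)"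
    unfolding invariant_under_def
  proof (intro equalityI subsetI)
    fix D assume "D \<in> (\<lambda>D. (rotation n ^^ j) ` D) ` edges_of n R"
    then obtain x y where xy: "(x, y) \<in> R" "D = (rotation n ^^ j) ` edge n x y"
      by (auto elim: edges_ofE)
    then show "D \<in> edges_of n R"
      using edges_ofI[OF arc_systemD(3)[OF R xy(1), of 1]] rotation_edge[OF n3(2)] by simp
  next
    fix D assume "D \<in> edges_of n R"
    then obtain x y where xy: "(x, y) \<in> R" "D = edge n x y" by (rule edges_ofE)
    have "(rotation n ^^ j) ` edge n (x - int j) (y - int j) = D"
      using rotation_edge[OF n3(2)] xy by simp
    moreover have "edge n (x - int j) (y - int j) \<in> edges_of n R"
      using edges_ofI[OF arc_systemD(3)[OF R xy(1), of "-1"]] by simp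
    ultimately show "D \<in> (\<lambda>D. (rotation n ^^ j) ` D) ` edges_of n R" by blast
  qed
  have per: "(x + k * int n, y + k * int n) \<in> R" if "(x, y) \<in> R" for x y k
    using arc_systemD(3)[OF R that, of "k * int d"] n by (simp add: mult.assoc)
  have "bij_betw (\<lambda>(x, y). edge n x y) (base_arcs n R) (edges_of n R)"
    unfolding bij_betw_def
  proof
    show "inj_on (\<lambda>(x, y). edge n x y) (base_arcs n R)"
    proof (rule inj_onI, clarify)
      fix x y u v assume a: "(x, y) \<in> base_arcs n R" "(u, v) \<in> base_arcs n R" "edge n x y = edge n u v"
      have l: "x + 2 \<le> y" "y < x + int j" "u + 2 \<le> v" "v < u + int j"
        using a arc_systemD(1,2)[OF R] by (auto simp: base_arcs_def)
      have b: "0 \<le> x" "x < int n" "0 \<le> u" "u < int n" using a by (auto simp: base_arcs_def)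
      \<comment> \<open>Two arcs on opposite sides of the same chord would have lengths adding up to
        a multiple of \<open>n\<close>, but the sum is positive and below
        \<open>2 * j\<close>.\<close>
      have "\<not> (x mod int n = v mod int n \<and> y mod int n = u mod int n)"
      proof
        assume "x mod int n = v mod int n \<and> y mod int n = u mod int n"
        then have "int n dvd (y - x) + (v - u)"
          using dvd_add[of "int n" "v - x" "y - u"] by (simp add: mod_eq_dvd_iff algebra_simps)
            (metis dvd_minus_iff minus_diff_eq dvd_add add.commute diff_add_eq add_diff_eq)
        then show False using l nj zdvd_imp_le by fastforce
      qed
      then have e: "x mod int n = u mod int n" "y mod int n = v mod int n"
        using a(3) n3 by (auto simp: edge_eq_iff)
      have "x = u" using mod_eq_imp_eq[OF e(1)] b by linarith
      moreover have "y = v" using mod_eq_imp_eq[OF e(2)] l nj \<open>x = u\<close> by linarith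
      ultimately show "x = u \<and> y = v" by simp
    qed
    show "(\<lambda>(x, y). edge n x y) ` base_arcs n R = edges_of n R"
    proof (intro equalityI subsetI)
      fix D assume "D \<in> edges_of n R"
      then obtain x y where xy: "(x, y) \<in> R" "D = edge n x y" by (rule edges_ofE)
      define q where "q = - (x div int n)"
      have "x + q * int n = x mod int n" using minus_div_mult_eq_mod[of x "int n"] by (simp add: q_def)
      then have "(x + q * int n, y + q * int n) \<in> base_arcs n R"
        using per[OF xy(1), of q] n3 by (auto simp: base_arcs_def)
      moreover have "D = edge n (x + q * int n) (y + q * int n)" using xy by (simp add: edge_shift)
      ultimately show "D \<in> (\<lambda>(x, y). edge n x y) ` base_arcs n R" by force
    qed (auto simp: base_arcs_def edges_of_def)
  qed
  then have "card (edges_of n R) = card (base_arcs (d * j) R)"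
    using bij_betw_same_card n by metis
  also have "\<dots> = d * card (base_arcs j R)"
    by (rule card_periodic) (use arc_systemD(3)[OF R] j in auto)
  finally show "card (edges_of n R) = d * card (base_arcs j R)" .
  \<comment> \<open>The complement of at most half a turn has length at least
    \<open>n / 2 \<ge> j\<close>, too long for an arc of \<open>R\<close>.\<close>
  have half: "\<not> (2 * (y - x) \<le> int n \<and> (y, x + int n) \<in> R)" for x y
    using arc_systemD(2)[OF R, of y "x + int n"] nj by force
  have nd: "\<forall>D\<in>edges_of n R. 0 \<notin> chord n D"
  proof
    fix D assume "D \<in> edges_of n R"
    then obtain x y where xy: "(x, y) \<in> R" "D = edge n x y" by (rule edges_ofE)
    then show "0 \<notin> chord n D"
      using arc_systemD(1,2)[OF R xy(1)] nj zero_in_chord_iff[OF n3(1), of x y] by auto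
  qed
  have memR: "edge n x y \<in> edges_of n R \<longleftrightarrow> (x, y) \<in> R" if "x < y" "2 * (y - x) \<le> int n" for x y
    using mem[of x y] half[of y x] that n3 edges_ofI[of x y R n] by auto
  show "arcs_of n j (edges_of n R) = R"
  proof (intro equalityI subsetI; clarify)
    fix x y assume "(x, y) \<in> arcs_of n j (edges_of n R)"
    then show "(x, y) \<in> R" using memR[of x y] nj by (auto simp: arcs_of_def)
  next
    fix x y assume "(x, y) \<in> R"
    then show "(x, y) \<in> arcs_of n j (edges_of n R)"
      using arc_systemD(1,2)[OF R, of x y] edges_ofI[of x y R n] by (auto simp: arcs_of_def)
  qed
  have "central_polygon n (edges_of n R) = uncovered_labels n R"
    unfolding central_polygon_eq[OF n3(1) sub nd] uncovered_labels_def
  proof (intro Collect_cong conj_cong refl iffI)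
    fix v assume a: "\<forall>x y. x < int v \<longrightarrow> int v < y \<longrightarrow> 2 * (y - x) < int n \<longrightarrow> edge n x y \<notin> edges_of n R"
    show "uncovered R (int v)" unfolding uncovered_def
    proof (intro allI impI, rule ccontr)
      fix x y assume "(x, y) \<in> R" "x < int v" "\<not> y \<le> int v"
      then show False using a[rule_format, of x y] nj arc_systemD(2)[OF R, of x y] edges_ofI[of x y R n] by auto
    qed
  next
    fix v assume a: "uncovered R (int v)"
    show "\<forall>x y. x < int v \<longrightarrow> int v < y \<longrightarrow> 2 * (y - x) < int n \<longrightarrow> edge n x y \<notin> edges_of n R"
    proof (intro allI impI notI)
      fix x y assume "x < int v" "int v < y" "2 * (y - x) < int n" "edge n x y \<in> edges_of n R"
      then show False using a memR[of x y] unfolding uncovered_def by force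
    qed
  qed
  then show "card (central_polygon n (edges_of n R)) = d * card (uncovered_labels j R)"
    using card_uncovered_labels_mult[OF R, of d] j n by simp
qed

lemma bij_betw_invariant_dissections:
  assumes n: "n = d * j" and d: "2 \<le> d" and j: "3 \<le> j" and r: "2 \<le> r"
  shows "bij_betw (arcs_of n j) (invariant_dissections (r * d) n k (rotation n ^^ j))
    {R. arc_system j R \<and> card (uncovered_labels j R) = r \<and> d * card (base_arcs j R) = k}"
proof (rule bij_betw_byWitness[where f' = "edges_of n"])
  show "\<forall>\<Theta>\<in>invariant_dissections (r * d) n k (rotation n ^^ j). edges_of n (arcs_of n j \<Theta>) = \<Theta>"
    using arcs_of_invariant_dissection(2)[OF assms] by blast
  show "\<forall>R\<in>{R. arc_system j R \<and> card (uncovered_labels j R) = r \<and> d * card (base_arcs j R) = k}.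
     arcs_of n j (edges_of n R) = R"
    using edges_of_arc_system(5)[OF n d j] by blast
  show "arcs_of n j ` invariant_dissections (r * d) n k (rotation n ^^ j) \<subseteq>
     {R. arc_system j R \<and> card (uncovered_labels j R) = r \<and> d * card (base_arcs j R) = k}"
  proof clarify
    fix \<Theta> assume \<Theta>: "\<Theta> \<in> invariant_dissections (r * d) n k (rotation n ^^ j)"
    have "card \<Theta> = k" using \<Theta> by (simp add: invariant_dissections_def dissections_def)
    then show "arc_system j (arcs_of n j \<Theta>) \<and> card (uncovered_labels j (arcs_of n j \<Theta>)) = r \<and>
        d * card (base_arcs j (arcs_of n j \<Theta>)) = k"
      using arcs_of_invariant_dissection[OF assms \<Theta>] edges_of_arc_system(3)[OF n d j] by metis
  qed
  show "edges_of n ` {R. arc_system j R \<and> card (uncovered_labels j R) = r \<and> d * card (base_arcs j R) = k}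
     \<subseteq> invariant_dissections (r * d) n k (rotation n ^^ j)"
    using edges_of_arc_system[OF n d j] by (auto simp: invariant_dissections_def dissections_def)
qed

section \<open>Pointed dissections\<close>

text \<open>
  The disjunct \<open>y = x + int j - 1\<close> stands for a side of the \<open>j\<close>-gon, seen as its long complementary
  arc. Such an arc can only avoid \<open>\<beta>\<close> if \<open>\<beta>\<close> is contained in this side.
\<close>

definition face_arcs :: "nat \<Rightarrow> nat set set \<Rightarrow> nat set \<Rightarrow> (int \<times> int) set" where
  "face_arcs j \<Theta> \<beta> = {(x, y). x + 2 \<le> y \<and> y < x + int j \<and>
     (edge j x y \<in> \<Theta> \<or> y = x + int j - 1) \<and>
     (\<forall>z. x < z \<longrightarrow> z < y \<longrightarrow> nat (z mod int j) \<notin> \<beta>)}"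

text \<open>One description of the admissible pairs for all component sizes;
  \<open>pointed_dissections_iff\<close> shows that it yields edges for size 2 and faces from size 3
  on. The last clause makes \<beta> maximal.\<close>

definition pointed :: "nat \<Rightarrow> nat set set \<Rightarrow> nat set \<Rightarrow> bool" where
  "pointed j \<Theta> \<beta> \<longleftrightarrow> is_dissection j \<Theta> \<and> \<beta> \<subseteq> {..<j} \<and> splits_none j \<Theta> \<beta> \<and>
     (\<forall>z. nat (z mod int j) \<notin> \<beta> \<longrightarrow> \<not> uncovered (face_arcs j \<Theta> \<beta>) z)"

text \<open>One turn starting at \<open>x\<close> meets every label. The case \<open>y = x\<close>
  is used too; the edge then degenerates to one label.\<close>

lemma subset_edge:
  assumes "\<beta> \<subseteq> {..<j}"
    and "\<And>z. x < z \<Longrightarrow> z < x + int j \<Longrightarrow> z \<noteq> y \<Longrightarrow> nat (z mod int j) \<notin> \<beta>"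
  shows "\<beta> \<subseteq> edge j x y"
proof
  fix v assume v: "v \<in> \<beta>"
  then have vj: "v < j" using assms(1) by auto
  then have j: "int j > 0" by simp
  obtain z where z: "x \<le> z" "z < x + int j" "z mod int j = int v mod int j"
    using lift_exists[OF j] by metis
  have zv: "nat (z mod int j) = v" using z(3) vj by simp
  then have "z = x \<or> z = y" using assms(2)[of z] z v by force
  then show "v \<in> edge j x y" using zv by (auto simp: edge_def)
qed

lemma card_edge_le: "card (edge j x y) \<le> 2"
  by (simp add: edge_def card_insert_if)

lemma card_subset_edge: "\<beta> \<subseteq> edge j x y \<Longrightarrow> card \<beta> \<le> 2"
  using card_edge_le[of j x y] card_mono[of "edge j x y" \<beta>] by (simp add: edge_def)

lemma subset_edge_eq: "\<beta> \<subseteq> edge j x y \<Longrightarrow> card \<beta> = 2 \<Longrightarrow> \<beta> = edge j x y"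
  using card_edge_le[of j x y] by (intro card_seteq) (auto simp: edge_def)

lemma mem_edge_iff:
  assumes "j > 0"
  shows "nat (z mod int j) \<in> edge j x y \<longleftrightarrow> z mod int j = x mod int j \<or> z mod int j = y mod int j"
  using assms by (simp add: edge_def eq_nat_nat_iff)

lemma strictly_inside_not_in_edge:
  assumes "x < z" "z < y" "y < x + int j"
  shows "nat (z mod int j) \<notin> edge j x y"
proof -
  have "j > 0" using assms by (cases j) auto
  then show ?thesis
    using mod_eq_imp_eq[of z "int j" x] mod_eq_imp_eq[of z "int j" y] assms by (auto simp: mem_edge_iff)
qed

text \<open>Interlacing arcs that fit into one turn would be crossing diagonals of \<Theta>, and if
  they do not fit they leave room for only one label of \<beta>. A long arc, of length
  \<open>j - 1\<close>, has both ends in \<beta>, so an arc interlacing with it would have a label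
  of \<beta> in its interior.\<close>

lemma arc_system_face_arcs:
  assumes j: "3 \<le> j" and p: "pointed j \<Theta> \<beta>" and c: "2 \<le> card \<beta>"
  shows "arc_system j (face_arcs j \<Theta> \<beta>)"
    and "uncovered_labels j (face_arcs j \<Theta> \<beta>) = \<beta>"
proof -
  have \<beta>: "\<beta> \<subseteq> {..<j}" using p by (simp add: pointed_def)
  have cross: "\<And>x x' y y'. x < x' \<Longrightarrow> x' < y \<Longrightarrow> y < y' \<Longrightarrow> y' < x + int j \<Longrightarrow>
       edge j x y \<in> \<Theta> \<Longrightarrow> edge j x' y' \<in> \<Theta> \<Longrightarrow> False"
    using p is_dissection_iff[OF j] unfolding pointed_def by blast
  have long: "nat (x mod int j) \<in> \<beta> \<and> nat (y mod int j) \<in> \<beta>"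
    if a: "(x, y) \<in> face_arcs j \<Theta> \<beta>" "y = x + int j - 1" for x y
  proof -
    have "\<beta> \<subseteq> edge j x y"
      by (rule subset_edge[OF \<beta>]) (use a in \<open>auto simp: face_arcs_def\<close>)
    moreover have "\<not> \<beta> \<subseteq> {v}" for v using c card_mono[of "{v}" \<beta>] by auto
    ultimately show ?thesis by (auto simp: edge_def)
  qed
  show "arc_system j (face_arcs j \<Theta> \<beta>)"
    unfolding arc_system_def
  proof (intro conjI allI impI)
    fix x x' y y' assume a: "(x, y) \<in> face_arcs j \<Theta> \<beta>" "(x', y') \<in> face_arcs j \<Theta> \<beta>" "x < x'" "x' < y"
    show "y' \<le> y"
    proof (rule ccontr)
      assume n: "\<not> y' \<le> y"
      have e: "(\<forall>z. x < z \<longrightarrow> z < y \<longrightarrow> nat (z mod int j) \<notin> \<beta>)"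
        "(\<forall>z. x' < z \<longrightarrow> z < y' \<longrightarrow> nat (z mod int j) \<notin> \<beta>)" using a by (auto simp: face_arcs_def)
      have "y \<noteq> x + int j - 1" using long[of x y] e(2) a n by auto
      moreover have "y' \<noteq> x' + int j - 1" using long[of x' y'] e(1) a n by auto
      ultimately have "edge j x y \<in> \<Theta>" "edge j x' y' \<in> \<Theta>" using a by (auto simp: face_arcs_def)
      then have "\<not> y' < x + int j" using cross[of x x' y y'] a n by auto
      \<comment> \<open>Here the two overlapping arcs together cover everything strictly between
        \<open>x\<close> and \<open>x + j\<close>.\<close>
      then have "nat (z mod int j) \<notin> \<beta>" if "x < z" "z < x + int j" for z
        using e[rule_format, of z] that a by (cases "z < y") auto
      then have "\<beta> \<subseteq> edge j x x" by (intro subset_edge[OF \<beta>]) auto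
      then have "card \<beta> \<le> card {nat (x mod int j)}" by (intro card_mono) (auto simp: edge_def)
      then show False using c by simp
    qed
  next
    fix x y k assume a: "(x, y) \<in> face_arcs j \<Theta> \<beta>"
    have "nat (z mod int j) \<notin> \<beta>" if "x + k * int j < z" "z < y + k * int j" for z
    proof -
      have "nat ((z - k * int j) mod int j) \<notin> \<beta>" using a that by (auto simp: face_arcs_def)
      moreover have "(z - k * int j) mod int j = z mod int j" by (simp add: mod_eq_dvd_iff)
      ultimately show ?thesis by simp
    qed
    then show "(x + k * int j, y + k * int j) \<in> face_arcs j \<Theta> \<beta>"
      using a by (auto simp: face_arcs_def edge_shift)
  qed (auto simp: face_arcs_def)
  show "uncovered_labels j (face_arcs j \<Theta> \<beta>) = \<beta>"
  proof (intro equalityI subsetI)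
    fix v assume v: "v \<in> uncovered_labels j (face_arcs j \<Theta> \<beta>)"
    then have "nat (int v mod int j) = v" by (simp add: uncovered_labels_def)
    moreover have "uncovered (face_arcs j \<Theta> \<beta>) (int v)" using v by (simp add: uncovered_labels_def)
    ultimately show "v \<in> \<beta>" using p unfolding pointed_def by metis
  next
    fix v assume v: "v \<in> \<beta>"
    then have vj: "v < j" using \<beta> by auto
    have "uncovered (face_arcs j \<Theta> \<beta>) (int v)" unfolding uncovered_def
    proof (intro allI impI, rule ccontr)
      fix x y assume "(x, y) \<in> face_arcs j \<Theta> \<beta>" "x < int v" "\<not> y \<le> int v"
      then have "nat (int v mod int j) \<notin> \<beta>" by (auto simp: face_arcs_def simp del: of_nat_mod)
      then show False using v vj by simp
    qed
    then show "v \<in> uncovered_labels j (face_arcs j \<Theta> \<beta>)" using vj by (simp add: uncovered_labels_def)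
  qed
qed

text \<open>Since \<open>q < p + j\<close>, no integer strictly between \<open>p\<close> and
  \<open>q\<close> reduces to one of their labels, so \<open>p\<close> and \<open>q\<close> bound a
  gap for \<open>closing_arc\<close>. This produces the arcs along a digon.\<close>

lemma closing_arc_edge:
  assumes R: "arc_system j R" and u: "uncovered_labels j R = edge j p q"
    and pq: "p + 2 \<le> q" "q < p + int j"
  shows "(p, q) \<in> R"
proof -
  have j: "j > 0" using pq by (cases j) auto
  have un: "uncovered R z \<longleftrightarrow> nat (z mod int j) \<in> edge j p q" for z
    using uncovered_mod[OF R j] u by simp
  show ?thesis
  proof (rule closing_arc[OF R pq(1)])
    show "uncovered R p" "uncovered R q" unfolding un by (simp_all add: edge_def)
    show "\<not> uncovered R z" if "p < z" "z < q" for z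
      unfolding un using strictly_inside_not_in_edge that pq(2) by blast
  qed
qed

text \<open>A chord with the two ends of \<beta> on different sides would cross \<beta> if that is a
  diagonal, and a side has adjacent ends, which no chord separates. Every other label lies under one
  of the two arcs of \<beta> itself.\<close>

lemma pointed_side_or_diagonal:
  assumes j: "3 \<le> j" and d: "is_dissection j \<Theta>" and \<beta>: "\<beta> \<in> sides j \<union> \<Theta>"
  shows "pointed j \<Theta> \<beta>" and "card \<beta> = 2"
proof -
  have j0: "j > 0" using j by simp
  have sub: "\<Theta> \<subseteq> diagonals j" using d by (simp add: is_dissection_def)
  have cross: "\<And>x x' y y'. x < x' \<Longrightarrow> x' < y \<Longrightarrow> y < y' \<Longrightarrow> y' < x + int j \<Longrightarrow>
       edge j x y \<in> \<Theta> \<Longrightarrow> edge j x' y' \<in> \<Theta> \<Longrightarrow> False"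
    using d is_dissection_iff[OF j] by blast
  have "\<exists>a b. \<beta> = {a, b} \<and> a < j \<and> b < j \<and> a \<noteq> b"
  proof (cases "\<beta> \<in> sides j")
    case True
    then obtain v where v: "v < j" "\<beta> = {v, (v + 1) mod j}" by (auto simp: sides_def)
    moreover have "(v + 1) mod j \<noteq> v" using v j by (cases "v + 1 = j") auto
    ultimately show ?thesis using j0 by (metis mod_less_divisor)
  next
    case False
    then show ?thesis using \<beta> sub unfolding diagonals_def by blast
  qed
  then obtain a b where ab: "\<beta> = {a, b}" "a < j" "b < j" "a \<noteq> b" by blast
  show c2: "card \<beta> = 2" using ab by simp
  have sn: "splits_none j \<Theta> \<beta>" unfolding splits_none_def
  proof (intro allI impI, rule ccontr)
    fix x y assume xy: "x < y" "y < x + int j" "edge j x y \<in> \<Theta>"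
      and "\<not> ((\<forall>z. x < z \<longrightarrow> z < y \<longrightarrow> nat (z mod int j) \<notin> \<beta>) \<or>
           (\<forall>z. y < z \<longrightarrow> z < x + int j \<longrightarrow> nat (z mod int j) \<notin> \<beta>))"
    then obtain z w where zw: "x < z" "z < y" "nat (z mod int j) \<in> \<beta>" "y < w" "w < x + int j"
        "nat (w mod int j) \<in> \<beta>" by blast
    have "z mod int j \<noteq> w mod int j" using mod_eq_imp_eq[of z "int j" w] zw by linarith
    then have "nat (z mod int j) \<noteq> nat (w mod int j)" using j0 by (simp add: eq_nat_nat_iff)
    then have e: "\<beta> = edge j z w" using zw ab unfolding edge_def by auto
    show False
    proof (cases "\<beta> \<in> \<Theta>")
      case True then show False using cross[of x z y w] xy zw e by simp
    next
      case False
      then have "edge j z w \<in> sides j" using \<beta> e by simp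
      then show False using edge_in_sides_iff[OF j, of z w] zw by auto
    qed
  qed
  have "\<not> uncovered (face_arcs j \<Theta> \<beta>) z" if z: "nat (z mod int j) \<notin> \<beta>" for z
  proof -
    obtain x1 y1 where xy1: "z \<le> x1" "x1 < y1" "y1 < z + int j" "\<beta> = edge j x1 y1"
      using pair_lift[OF ab(2,3,4)] ab(1) by metis
    \<comment> \<open>The lift of \<beta> starts after \<open>z\<close>, so its complementary arc is
      the one over \<open>z\<close>.\<close>
    define x where "x = y1 - int j"
    have e: "\<beta> = edge j x x1" using xy1(4) edge_swap[of j x1 x] edge_commute by (simp add: x_def)
    have "z \<noteq> x1" using z xy1(4) by (auto simp: edge_def)
    then have lt: "x < z" "z < x1" "x1 < x + int j" using xy1 by (auto simp: x_def)
    have "edge j x x1 \<in> \<Theta> \<or> x1 = x + int j - 1"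
      using \<beta> e edge_in_sides_iff[OF j, of x x1] lt by auto
    then have "(x, x1) \<in> face_arcs j \<Theta> \<beta>"
      using lt strictly_inside_not_in_edge[of x _ x1 j] by (auto simp: face_arcs_def e)
    then show ?thesis using lt unfolding uncovered_def by force
  qed
  then show "pointed j \<Theta> \<beta>" unfolding pointed_def using d sn ab by auto
qed

text \<open>For size 2, \<open>closing_arc_edge\<close> puts an edge \<beta> with nonadjacent ends
  into \<Theta>, up to the side joining the first and last label. From size 3 on, no long arc can
  miss \<beta>, so the extra disjunct of \<open>face_arcs\<close> is empty and
  \<open>faces_iff\<close> applies.\<close>

lemma pointed_dissections_iff:
  assumes j: "3 \<le> j" and r: "2 \<le> r"
  shows "(\<Theta>, \<beta>) \<in> pointed_dissections r j l \<longleftrightarrow>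
    pointed j \<Theta> \<beta> \<and> card \<beta> = r \<and> real (card \<Theta>) = l"
proof (cases "r = 2")
  case True
  have "\<beta> \<in> sides j \<union> \<Theta>" if p: "pointed j \<Theta> \<beta>" and c: "card \<beta> = 2"
  proof -
    have \<beta>: "\<beta> \<subseteq> {..<j}" using p by (simp add: pointed_def)
    obtain a b where ab: "\<beta> = {a, b}" "a \<noteq> b" using c by (auto simp: card_2_iff)
    then have "a < j" "b < j" using \<beta> by auto
    then obtain x y where xy: "0 \<le> x" "x < y" "y < 0 + int j" "\<beta> = edge j x y"
      using pair_lift ab by metis
    note sys = arc_system_face_arcs[OF j p]
    show ?thesis
    proof (cases "y = x + 1")
      case True
      then show ?thesis using edge_in_sides_iff[OF j, of x y] xy by auto
    next
      case False
      then have "(x, y) \<in> face_arcs j \<Theta> \<beta>"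
        using closing_arc_edge[OF sys(1), of x y] sys(2) xy c by auto
      then show ?thesis using edge_in_sides_iff[OF j, of x y] xy by (auto simp: face_arcs_def)
    qed
  qed
  moreover have "is_dissection j \<Theta>" if "pointed j \<Theta> \<beta>" using that by (simp add: pointed_def)
  ultimately show ?thesis
    using True pointed_side_or_diagonal[OF j, of \<Theta> \<beta>]
    by (auto simp: pointed_dissections_def dissections_def r_components_def)
next
  case False
  then have r3: "r \<ge> 3" using r by simp
  have "\<beta> \<in> faces j \<Theta> \<longleftrightarrow> \<beta> \<subseteq> {..<j} \<and> splits_none j \<Theta> \<beta> \<and>
     (\<forall>z. nat (z mod int j) \<notin> \<beta> \<longrightarrow> \<not> uncovered (face_arcs j \<Theta> \<beta>) z)"
    if d: "is_dissection j \<Theta>" and c: "card \<beta> = r"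
  proof -
    have sub: "\<Theta> \<subseteq> diagonals j" using d by (simp add: is_dissection_def)
    have c3: "card \<beta> \<ge> 3" using c r3 by simp
    have "(\<exists>x y. x < z \<and> z < y \<and> y < x + int j \<and> edge j x y \<in> \<Theta> \<and>
       (\<forall>w. x < w \<longrightarrow> w < y \<longrightarrow> nat (w mod int j) \<notin> \<beta>)) \<longleftrightarrow> \<not> uncovered (face_arcs j \<Theta> \<beta>) z"
      (is "?L \<longleftrightarrow> ?R") if \<beta>: "\<beta> \<subseteq> {..<j}" for z
    proof
      assume ?L
      then obtain x y where xy: "x < z" "z < y" "y < x + int j" "edge j x y \<in> \<Theta>"
        "\<forall>w. x < w \<longrightarrow> w < y \<longrightarrow> nat (w mod int j) \<notin> \<beta>" by blast
      then have "(x, y) \<in> face_arcs j \<Theta> \<beta>" by (simp add: face_arcs_def)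
      then show ?R using xy unfolding uncovered_def by force
    next
      assume ?R
      then obtain x y where xy: "(x, y) \<in> face_arcs j \<Theta> \<beta>" "x < z" "z < y"
        unfolding uncovered_def by force
      have "y \<noteq> x + int j - 1"
      proof
        assume "y = x + int j - 1"
        then have "\<beta> \<subseteq> edge j x y"
          by (intro subset_edge[OF \<beta>]) (use xy in \<open>auto simp: face_arcs_def\<close>)
        then show False using card_subset_edge[of \<beta> j x y] c3 by simp
      qed
      then show ?L using xy by (intro exI[of _ x] exI[of _ y]) (auto simp: face_arcs_def)
    qed
    then show ?thesis unfolding faces_iff[OF j sub c3] by blast
  qed
  then show ?thesis using False r3
    by (auto simp: pointed_dissections_def dissections_def r_components_def pointed_def)
qed

section \<open>Counting the arcs of a pointed dissection\<close>

lemma base_arcs_rep: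
  assumes "arc_system j R" "(x, y) \<in> R" "j > 0"
  obtains u v where "(u, v) \<in> base_arcs j R" "edge j u v = edge j x y" "u = x mod int j"
proof
  define q where "q = - (x div int j)"
  have "x + q * int j = x mod int j" using minus_div_mult_eq_mod[of x "int j"] by (simp add: q_def)
  then show "(x mod int j, y + q * int j) \<in> base_arcs j R"
    using arc_systemD(3)[OF assms(1,2), of q] assms(3) by (auto simp: base_arcs_def)
  show "edge j (x mod int j) (y + q * int j) = edge j x y" by (simp add: edge_def)
qed simp

lemma base_arcs_same_edge:
  assumes "arc_system j R" "(x, y) \<in> base_arcs j R" "(u, v) \<in> base_arcs j R"
    and "edge j x y = edge j u v"
  shows "(x, y) = (u, v) \<or> (u = y mod int j \<and> u \<noteq> x \<and> (y, x + int j) \<in> R)"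
proof -
  have b: "0 \<le> x" "x < int j" "0 \<le> u" "u < int j" "(x, y) \<in> R" "(u, v) \<in> R"
    using assms(2,3) by (auto simp: base_arcs_def)
  then have j: "j > 0" by (cases j) auto
  have l: "x + 2 \<le> y" "y < x + int j" "u + 2 \<le> v" "v < u + int j"
    using arc_systemD(1,2)[OF assms(1)] b by blast+
  consider "x mod int j = u mod int j" "y mod int j = v mod int j"
    | "x mod int j = v mod int j" "y mod int j = u mod int j"
    using assms(4) j by (auto simp: edge_eq_iff)
  then show ?thesis
  proof cases
    case 1
    then have "x = u" using b by simp
    moreover have "y = v" using mod_eq_imp_eq[OF 1(2)] l \<open>x = u\<close> by linarith
    ultimately show ?thesis by simp
  next
    case 2
    have "y mod int j \<noteq> x mod int j" using mod_eq_imp_eq[of y "int j" x] l by linarith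
    then have "u = y mod int j" "u \<noteq> x" using 2 b by auto
    obtain k where k: "y = u + k * int j" using mod_eq_obtain[OF 2(2)] by metis
    then have "(y, v + k * int j) \<in> R" using arc_systemD(3)[OF assms(1) b(6)] by simp
    moreover have "(v + k * int j) mod int j = (x + int j) mod int j" using 2 by simp
    then have "v + k * int j = x + int j"
      using mod_eq_imp_eq[of "v + k * int j" "int j" "x + int j"] l k by linarith
    ultimately show ?thesis using \<open>u = y mod int j\<close> \<open>u \<noteq> x\<close> by simp
  qed
qed

text \<open>Two complementary arcs leave only their common endpoints for \<beta>. Hence a chord can
  be used in both directions only if \<beta> lies on it.\<close>

lemma face_arcs_both:
  assumes "\<beta> \<subseteq> {..<j}" "(x, y) \<in> face_arcs j \<Theta> \<beta>" "(y, x + int j) \<in> face_arcs j \<Theta> \<beta>"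
  shows "\<beta> \<subseteq> edge j x y"
proof (rule subset_edge[OF assms(1)])
  fix z assume "x < z" "z < x + int j" "z \<noteq> y"
  then show "nat (z mod int j) \<notin> \<beta>" using assms(2,3) by (cases "z < y") (auto simp: face_arcs_def)
qed

text \<open>Intersecting with the diagonals discards the long arcs, whose edges are sides;
  \<open>splits_none\<close> gives every diagonal of \<Theta> at least one direction that misses
  \<beta>.\<close>

lemma edges_of_face_arcs:
  assumes j: "3 \<le> j" and p: "pointed j \<Theta> \<beta>"
  shows "edges_of j (face_arcs j \<Theta> \<beta>) \<inter> diagonals j = \<Theta>"
proof (intro equalityI subsetI)
  have sub: "\<Theta> \<subseteq> diagonals j" and sn: "splits_none j \<Theta> \<beta>"
    using p by (auto simp: pointed_def is_dissection_def)
  {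
    fix D assume D: "D \<in> edges_of j (face_arcs j \<Theta> \<beta>) \<inter> diagonals j"
    then obtain x y where xy: "(x, y) \<in> face_arcs j \<Theta> \<beta>" "D = edge j x y" by (blast elim: edges_ofE)
    then have "y \<noteq> x + int j - 1" using D edge_in_diagonals_iff[OF j, of x y] by (auto simp: face_arcs_def)
    then show "D \<in> \<Theta>" using xy by (auto simp: face_arcs_def)
  }
  fix D assume D: "D \<in> \<Theta>"
  then obtain x y where xy: "0 \<le> x" "x < y" "y < 0 + int j" "D = edge j x y"
    using diagonal_lift sub by (metis subsetD)
  then have l: "x + 2 \<le> y" "y \<le> x + int j - 2"
    using edge_in_diagonals_iff[OF j, of x y] D sub by auto
  have lt: "y < x + int j" using xy by simp
  have "(\<forall>z. x < z \<longrightarrow> z < y \<longrightarrow> nat (z mod int j) \<notin> \<beta>) \<or>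
     (\<forall>z. y < z \<longrightarrow> z < x + int j \<longrightarrow> nat (z mod int j) \<notin> \<beta>)"
    using sn lt D xy(2,4) unfolding splits_none_def by blast
  then have "(x, y) \<in> face_arcs j \<Theta> \<beta> \<or> (y, x + int j) \<in> face_arcs j \<Theta> \<beta>"
  proof
    assume "\<forall>z. x < z \<longrightarrow> z < y \<longrightarrow> nat (z mod int j) \<notin> \<beta>"
    then have "(x, y) \<in> face_arcs j \<Theta> \<beta>" unfolding face_arcs_def using l D xy(4) by simp
    then show ?thesis ..
  next
    assume "\<forall>z. y < z \<longrightarrow> z < x + int j \<longrightarrow> nat (z mod int j) \<notin> \<beta>"
    then have "(y, x + int j) \<in> face_arcs j \<Theta> \<beta>"
      unfolding face_arcs_def using l D xy by (simp add: edge_swap)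
    then show ?thesis ..
  qed
  then have "D \<in> edges_of j (face_arcs j \<Theta> \<beta>)"
    using edges_ofI[of x y _ j] edges_ofI[of y "x + int j" _ j] xy(4) edge_swap[of j y x] by auto
  then show "D \<in> edges_of j (face_arcs j \<Theta> \<beta>) \<inter> diagonals j" using D sub by blast
qed

text \<open>
  For a face \<open>\<beta>\<close> with at least three vertices, every diagonal has exactly one orientation whose open
  arc misses \<open>\<beta>\<close>. If \<open>\<beta>\<close> is an edge, then \<open>\<beta>\<close> itself accounts for one additional arc: a diagonal
  \<open>\<beta>\<close> has two such orientations, and a side \<open>\<beta>\<close>, which is not in \<open>\<Theta>\<close>, has its complementary long arc.
\<close>

lemma card_base_face_arcs:
  assumes j: "3 \<le> j" and p: "pointed j \<Theta> \<beta>" and c: "2 \<le> card \<beta>"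
  shows "card (base_arcs j (face_arcs j \<Theta> \<beta>)) = card \<Theta> + of_bool (card \<beta> = 2)"
proof -
  let ?R = "face_arcs j \<Theta> \<beta>" and ?e = "\<lambda>(x, y). edge j x y"
  let ?B = "base_arcs j ?R"
  have j0: "j > 0" using j by simp
  have \<beta>: "\<beta> \<subseteq> {..<j}" and sub: "\<Theta> \<subseteq> diagonals j"
    using p by (auto simp: pointed_def is_dissection_def)
  note sys = arc_system_face_arcs[OF assms]
  have in_\<Theta>: "edge j x y \<in> \<Theta> \<or> (y = x + int j - 1 \<and> \<beta> \<subseteq> edge j x y)" if "(x, y) \<in> ?B" for x y
  proof (cases "y = x + int j - 1")
    case True
    then have "\<beta> \<subseteq> edge j x y"
      by (intro subset_edge[OF \<beta>]) (use that in \<open>auto simp: base_arcs_def face_arcs_def\<close>)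
    then show ?thesis using True by simp
  next
    case False then show ?thesis using that by (auto simp: base_arcs_def face_arcs_def)
  qed
  have inj: "\<beta> \<subseteq> edge j x y \<and> u = y mod int j \<and> u \<noteq> x"
    if "(x, y) \<in> ?B" "(u, v) \<in> ?B" "edge j x y = edge j u v" "(x, y) \<noteq> (u, v)" for x y u v
    using base_arcs_same_edge[OF sys(1) that(1-3)] that face_arcs_both[OF \<beta>, of x y \<Theta>]
    by (auto simp: base_arcs_def)
  have surj: "\<exists>x y. (x, y) \<in> ?B \<and> edge j x y = D" if "D \<in> \<Theta>" for D
  proof -
    have "D \<in> edges_of j ?R" using edges_of_face_arcs[OF j p] that by blast
    then obtain x y where "(x, y) \<in> ?R" "D = edge j x y" by (rule edges_ofE)
    then show ?thesis using base_arcs_rep[OF sys(1) _ j0] by metis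
  qed
  show ?thesis
  proof (cases "card \<beta> = 2")
    case False
    then have no: "\<not> \<beta> \<subseteq> edge j x y" for x y using card_subset_edge[of \<beta> j x y] c by auto
    have "bij_betw ?e ?B \<Theta>"
      unfolding bij_betw_def
    proof
      show "inj_on ?e ?B" using inj no by (intro inj_onI) (auto simp: split_beta; metis prod.collapse)
      show "?e ` ?B = \<Theta>"
      proof (intro equalityI subsetI)
        fix D assume "D \<in> ?e ` ?B"
        then show "D \<in> \<Theta>" using in_\<Theta> no by auto
      next
        fix D assume "D \<in> \<Theta>"
        then show "D \<in> ?e ` ?B" using surj by force
      qed
    qed
    then show ?thesis using bij_betw_same_card False by fastforce
  next
    case True
    obtain a b where ab: "\<beta> = {a, b}" "a \<noteq> b" using True by (auto simp: card_2_iff)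
    then have "a < j" "b < j" using \<beta> by auto
    then obtain x1 y1 where xy1: "0 \<le> x1" "x1 < y1" "y1 < 0 + int j" "\<beta> = edge j x1 y1"
      using pair_lift ab by metis
    have "\<exists>x y. (x, y) \<in> ?B \<and> edge j x y = \<beta>"
    proof (cases "y1 = x1 + 1")
      case True
      \<comment> \<open>The direct arc has length 1 and is no arc of the system, so the side is
        represented by its complement.\<close>
      have "(y1, x1 + int j) \<in> ?R"
        by (rule closing_arc_edge[OF sys(1)]) (use sys(2) xy1 edge_swap[of j y1 x1] True j in auto)
      then have "(y1, x1 + int j) \<in> ?B" using xy1 by (auto simp: base_arcs_def)
      then show ?thesis using xy1(4) edge_swap by metis
    next
      case False
      have "(x1, y1) \<in> ?R"
        by (rule closing_arc_edge[OF sys(1)]) (use sys(2) xy1 False in auto)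
      then have "(x1, y1) \<in> ?B" using xy1 by (auto simp: base_arcs_def)
      then show ?thesis using xy1 by metis
    qed
    then obtain s t where st: "(s, t) \<in> ?B" "edge j s t = \<beta>" by blast
    have l: "s + 2 \<le> t" "t < s + int j" "0 \<le> s" "s < int j"
      using st arc_systemD(1,2)[OF sys(1)] by (auto simp: base_arcs_def)
    have tm: "t mod int j \<noteq> s" using mod_eq_imp_eq[of t "int j" s] l by auto
    \<comment> \<open>Besides the chosen arc \<open>(s, t)\<close>, at most the complementary one
      lies on \<beta>. Removing \<open>(s, t)\<close> therefore leaves at most one arc for each
      edge.\<close>
    have other: "x = t mod int j" if "(x, y) \<in> ?B" "(x, y) \<noteq> (s, t)" "\<beta> \<subseteq> edge j x y" for x y
      using inj[OF st(1) that(1)] that subset_edge_eq[OF that(3) True] st by metis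
    have "bij_betw ?e (?B - {(s, t)}) \<Theta>"
      unfolding bij_betw_def
    proof
      show "inj_on ?e (?B - {(s, t)})"
      proof (rule inj_onI, rule ccontr)
        fix P Q assume PQ: "P \<in> ?B - {(s, t)}" "Q \<in> ?B - {(s, t)}" "?e P = ?e Q" "P \<noteq> Q"
        obtain x y u v where xy: "P = (x, y)" "Q = (u, v)" by fastforce
        have i: "\<beta> \<subseteq> edge j x y" "u \<noteq> x" using inj[of x y u v] PQ xy by auto
        moreover have "x = t mod int j" using other[of x y] PQ xy i by auto
        moreover have "u = t mod int j" using other[of u v] PQ xy i by auto
        ultimately show False by simp
      qed
      show "?e ` (?B - {(s, t)}) = \<Theta>"
      proof (intro equalityI subsetI)
        fix D assume "D \<in> ?e ` (?B - {(s, t)})"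
        then obtain x y where xy: "(x, y) \<in> ?B" "(x, y) \<noteq> (s, t)" "D = edge j x y" by auto
        \<comment> \<open>A remaining arc outside \<Theta> would be a long arc complementary to
          \<open>(s, t)\<close>. But \<open>t \<ge> s + 2\<close> limits that complement to length
          \<open>j - 2\<close>.\<close>
        show "D \<in> \<Theta>"
        proof (rule ccontr)
          assume "D \<notin> \<Theta>"
          then have y: "y = x + int j - 1" and sub: "\<beta> \<subseteq> edge j x y" using in_\<Theta>[OF xy(1)] xy(3) by auto
          have x: "x = t mod int j" using other xy sub by blast
          have "edge j x y = edge j s t" using subset_edge_eq[OF sub True] st by simp
          moreover have "x mod int j \<noteq> s mod int j" using x tm l by simp
          ultimately have "y mod int j = s mod int j" using j0 by (auto simp: edge_eq_iff)
          moreover have "y mod int j = (t - 1) mod int j"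
          proof -
            have "y mod int j = (x - 1) mod int j" using y by (simp add: mod_eq_dvd_iff)
            also have "\<dots> = (t - 1) mod int j" using x by (simp add: mod_diff_left_eq)
            finally show ?thesis .
          qed
          ultimately have "s mod int j = (t - 1) mod int j" by simp
          from mod_eq_imp_eq[OF this] show False using l by linarith
        qed
      next
        fix D assume D: "D \<in> \<Theta>"
        then obtain x y where xy: "(x, y) \<in> ?B" "edge j x y = D" using surj by blast
        show "D \<in> ?e ` (?B - {(s, t)})"
        proof (cases "(x, y) = (s, t)")
          case False then show ?thesis using xy by force
        next
          case True
          \<comment> \<open>The removed arc represented \<open>D\<close>, so \<beta> is a diagonal,
            and the complementary arc from \<open>t\<close> to \<open>s + j\<close> takes its
            place.\<close>
          then have e: "edge j s t \<in> \<Theta>" "D = \<beta>" using D xy st by auto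
          then have "t \<le> s + int j - 2" using sub edge_in_diagonals_iff[OF j, of s t] l by auto
          moreover have "nat (z mod int j) \<notin> \<beta>" if "t < z" "z < s + int j" for z
            using strictly_inside_not_in_edge[of t z "s + int j" j] that l st edge_swap[of j t s] by auto
          ultimately have "(t, s + int j) \<in> ?R"
            using l e by (auto simp: face_arcs_def edge_swap)
          then obtain u v where uv: "(u, v) \<in> ?B" "edge j u v = edge j t (s + int j)" "u = t mod int j"
            using base_arcs_rep[OF sys(1) _ j0] by metis
          then have "(u, v) \<in> ?B - {(s, t)}" using tm by auto
          moreover have "edge j u v = D" using uv(2) e st edge_swap by simp
          ultimately show ?thesis by force
        qed
      qed
    qed
    then have c1: "card (?B - {(s, t)}) = card \<Theta>" by (rule bij_betw_same_card)
    have "finite ?B"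
    proof (rule finite_subset)
      show "?B \<subseteq> {0..int j} \<times> {0..2 * int j}" by (auto simp: base_arcs_def face_arcs_def)
    qed simp
    then have "card ?B = Suc (card (?B - {(s, t)}))" using st(1) by (rule card.remove)
    then show ?thesis using True by (simp add: c1)
  qed
qed

text \<open>Suppose an arc of \<open>face_arcs\<close> were missing from \<open>R\<close>. Its
  complement then also avoids the uncovered labels: it is an arc of \<open>R\<close>, or has no
  interior integers if the arc is long. So these labels are just the two ends, and
  \<open>closing_arc_edge\<close> puts the arc into \<open>R\<close> after all.\<close>

lemma pointed_of_arc_system:
  assumes j: "3 \<le> j" and R: "arc_system j R" and c: "2 \<le> card (uncovered_labels j R)"
  shows "face_arcs j (edges_of j R \<inter> diagonals j) (uncovered_labels j R) = R"
    and "pointed j (edges_of j R \<inter> diagonals j) (uncovered_labels j R)"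
proof -
  let ?\<Theta> = "edges_of j R \<inter> diagonals j" and ?\<beta> = "uncovered_labels j R"
  have j0: "j > 0" using j by simp
  have \<beta>: "?\<beta> \<subseteq> {..<j}" by (auto simp: uncovered_labels_def)
  have jj: "j = 1 * j" by simp
  note un = uncovered_mod[OF R j0]
  note mem = edge_in_edges_of_arc_system[OF R zero_less_one jj]
  have inR: "nat (z mod int j) \<notin> ?\<beta>" if "(x, y) \<in> R" "x < z" "z < y" for x y z
    using that unfolding un uncovered_def by force
  show eq: "face_arcs j ?\<Theta> ?\<beta> = R"
  proof (intro equalityI subsetI; clarify)
    fix x y assume a: "(x, y) \<in> face_arcs j ?\<Theta> ?\<beta>"
    then have l: "x + 2 \<le> y" "y < x + int j" by (auto simp: face_arcs_def)
    show "(x, y) \<in> R"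
    proof (rule ccontr)
      assume n: "(x, y) \<notin> R"
      then have "?\<beta> \<noteq> edge j x y" using closing_arc_edge[OF R _ l] by blast
      moreover have "?\<beta> \<subseteq> edge j x y"
      proof (rule subset_edge[OF \<beta>])
        fix z assume z: "x < z" "z < x + int j" "z \<noteq> y"
        show "nat (z mod int j) \<notin> ?\<beta>"
        proof (cases "z < y")
          case True then show ?thesis using a z by (auto simp: face_arcs_def)
        next
          case False
          then have "y \<noteq> x + int j - 1" using z by auto
          then have "edge j x y \<in> edges_of j R" using a by (auto simp: face_arcs_def)
          then have "(y, x + int j) \<in> R" using mem[of x y] n l by auto
          then show ?thesis using inR z False by force
        qed
      qed
      ultimately show False
        using subset_edge_eq[of ?\<beta> j x y] card_subset_edge[of ?\<beta> j x y] c by auto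
    qed
  next
    fix x y assume a: "(x, y) \<in> R"
    have l: "x + 2 \<le> y" "y < x + int j" using arc_systemD(1,2)[OF R a] .
    have "edge j x y \<in> ?\<Theta> \<or> y = x + int j - 1"
      using edges_ofI[OF a, of j] edge_in_diagonals_iff[OF j, of x y] l by auto
    then show "(x, y) \<in> face_arcs j ?\<Theta> ?\<beta>" using l inR[OF a] unfolding face_arcs_def by blast
  qed
  have "is_dissection j ?\<Theta>"
    unfolding is_dissection_iff[OF j] using edges_of_noncrossing[OF R zero_less_one jj] by blast
  moreover have "splits_none j ?\<Theta> ?\<beta>" unfolding splits_none_def
  proof (intro allI impI)
    fix x y assume "x < y" "y < x + int j" "edge j x y \<in> ?\<Theta>"
    then have "(x, y) \<in> R \<or> (y, x + int j) \<in> R" using mem[of x y] by auto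
    then show "(\<forall>z. x < z \<longrightarrow> z < y \<longrightarrow> nat (z mod int j) \<notin> ?\<beta>) \<or>
       (\<forall>z. y < z \<longrightarrow> z < x + int j \<longrightarrow> nat (z mod int j) \<notin> ?\<beta>)" using inR by blast
  qed
  ultimately show "pointed j ?\<Theta> ?\<beta>" unfolding pointed_def eq un using \<beta> by blast
qed

lemma bij_betw_pointed_dissections:
  assumes j: "3 \<le> j" and r: "2 \<le> r" and d: "0 < d"
  shows "bij_betw (\<lambda>R. (edges_of j R \<inter> diagonals j, uncovered_labels j R))
    {R. arc_system j R \<and> card (uncovered_labels j R) = r \<and> d * card (base_arcs j R) = k}
    (pointed_dissections r j (real k / real d - of_bool (r = 2)))"
proof (rule bij_betw_byWitness[where f' = "\<lambda>(\<Theta>, \<beta>). face_arcs j \<Theta> \<beta>"])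
  let ?S = "{R. arc_system j R \<and> card (uncovered_labels j R) = r \<and> d * card (base_arcs j R) = k}"
    and ?P = "pointed_dissections r j (real k / real d - of_bool (r = 2))"
  \<comment> \<open>Dividing in the reals keeps the equivalence valid when \<open>d\<close> does not
    divide \<open>k\<close>: both sides are then false, and both sets are empty without a case
    distinction.\<close>
  have cnt: "d * card (base_arcs j (face_arcs j \<Theta> \<beta>)) = k \<longleftrightarrow>
      real (card \<Theta>) = real k / real d - of_bool (r = 2)"
    if p: "pointed j \<Theta> \<beta>" "card \<beta> = r" for \<Theta> \<beta>
  proof -
    have c: "card (base_arcs j (face_arcs j \<Theta> \<beta>)) = card \<Theta> + of_bool (r = 2)"
      using card_base_face_arcs[OF j p(1)] p(2) r by simp
    have "d * q = k \<longleftrightarrow> real q = real k / real d" for q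
      using d by (simp add: field_simps flip: of_nat_mult)
    then have "d * (card \<Theta> + of_bool (r = 2)) = k \<longleftrightarrow>
      real (card \<Theta> + of_bool (r = 2)) = real k / real d" .
    also have "\<dots> \<longleftrightarrow> real (card \<Theta>) = real k / real d - of_bool (r = 2)" by auto
    finally show ?thesis unfolding c .
  qed
  show "\<forall>R\<in>?S. (\<lambda>(\<Theta>, \<beta>). face_arcs j \<Theta> \<beta>) (edges_of j R \<inter> diagonals j, uncovered_labels j R) = R"
    using pointed_of_arc_system(1)[OF j] r by auto
  show "\<forall>a\<in>?P. (\<lambda>R. (edges_of j R \<inter> diagonals j, uncovered_labels j R)) ((\<lambda>(\<Theta>, \<beta>). face_arcs j \<Theta> \<beta>) a) = a"
  proof
    fix a assume P: "a \<in> ?P"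
    obtain \<Theta> \<beta> where a: "a = (\<Theta>, \<beta>)" by fastforce
    have "pointed j \<Theta> \<beta>" "card \<beta> = r" using P unfolding a pointed_dissections_iff[OF j r] by auto
    then show "(\<lambda>R. (edges_of j R \<inter> diagonals j, uncovered_labels j R)) ((\<lambda>(\<Theta>, \<beta>). face_arcs j \<Theta> \<beta>) a) = a"
      using edges_of_face_arcs[OF j] arc_system_face_arcs(2)[OF j] r by (simp add: a)
  qed
  show "(\<lambda>R. (edges_of j R \<inter> diagonals j, uncovered_labels j R)) ` ?S \<subseteq> ?P"
  proof (rule image_subsetI)
    fix R assume R: "R \<in> ?S"
    then have c: "2 \<le> card (uncovered_labels j R)" using r by simp
    have sys: "arc_system j R" using R by simp
    note q = pointed_of_arc_system[OF j sys c]
    show "(edges_of j R \<inter> diagonals j, uncovered_labels j R) \<in> ?P"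
      unfolding pointed_dissections_iff[OF j r] using q cnt[OF q(2)] R by auto
  qed
  show "(\<lambda>(\<Theta>, \<beta>). face_arcs j \<Theta> \<beta>) ` ?P \<subseteq> ?S"
  proof (rule image_subsetI)
    fix a assume P: "a \<in> ?P"
    obtain \<Theta> \<beta> where a: "a = (\<Theta>, \<beta>)" by fastforce
    have p: "pointed j \<Theta> \<beta>" "card \<beta> = r" "real (card \<Theta>) = real k / real d - of_bool (r = 2)"
      using P unfolding a pointed_dissections_iff[OF j r] by auto
    then have "d * card (base_arcs j (face_arcs j \<Theta> \<beta>)) = k" using cnt[OF p(1,2)] by blast
    then show "(\<lambda>(\<Theta>, \<beta>). face_arcs j \<Theta> \<beta>) a \<in> ?S"
      using arc_system_face_arcs[OF j p(1)] p(2) r by (simp add: a)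
  qed
qed

theorem theorem26:
  fixes n k r d j :: nat
  assumes "n \<ge> 3"
    and "1 \<le> k" and "k \<le> n - 3"
    and "r \<ge> 2"
    and "d dvd n" and "2 \<le> d" and "real d \<le> real n / 3"
    and "j = n div d"
  shows "\<exists>f. bij_betw f
           (invariant_dissections (r * d) n k (rotation n ^^ j))
           (pointed_dissections r j (real k / real d - of_bool (r = 2)))"
proof -
  have n: "n = d * j" using assms by simp
  have "3 * d \<le> n" using assms(7) by linarith
  then have "d * 3 \<le> d * j" using n by simp
  \<comment> \<open>The bound \<open>d \<le> n / 3\<close> is what makes the \<open>j\<close>-gon a
    genuine polygon.\<close>
  then have j: "3 \<le> j" using assms(6) by simp
  have d: "0 < d" using assms(6) by simp
  show ?thesis
    using bij_betw_trans[OF bij_betw_invariant_dissections[OF n assms(6) j assms(4)]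
        bij_betw_pointed_dissections[OF j assms(4) d]] by blast
qed

end
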